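(* Let $k,m\in\mathbb{N}$. Define $c_1=1$ and, for $k\geq 2$, $$c_k = \left\lceil \frac{k\ln(k+2)}{\ln 2+(k-1)\ln(k+2)-\ln\!\left(2(k+2)^{k-1}-(k+1)!\right)}\right\rceil.$$ Then $\chi_{DP}(C_{2m+1}\square K_{k,t}) = k+3$ whenever $$t\geq c_k\left(\frac{P_{DP}(C_{2m+1},k + 2)}{k+2}\right)^k = c_k\left(\frac{(k+1)^{2m+1} - (k+1)}{k+2}\right)^k.$$
   Context: $C_n$ is the cycle on $n$ vertices, $K_{k,t}$ the complete bipartite graph with parts of sizes $k$ and $t$, and $\square$ the Cartesian product ($(u,v)\sim(u',v')$ iff $u=u'$ and $vv'$ is an edge, or $v=v'$ and $uu'$ is an edge). A cover of a graph $G$ is a pair $\mathcal{H}=(L,H)$ with $H$ a graph and $L:V(G)\to\mathcal{P}(V(H))$ such that $\{L(v)\}$ partitions $V(H)$ into $|V(G)|$ parts, each $H[L(v)]$ is complete, edges of $H$ between distinct $L(u),L(v)$ occur only if $uv\in E(G)$, and for $uv\in E(G)$ these edges form a (possibly empty) matching; it is $m$-fold if all $|L(v)|=m$. An $\mathcal{H}$-coloring is an independent set of $H$ of size $|V(G)|$. $\chi_{DP}(G)$ is the least $m$ such that every $m$-fold cover admits an $\mathcal{H}$-coloring. $P_{DP}(G,m)$ is the minimum, over all $m$-fold covers $\mathcal{H}$ of $G$, of the number of $\mathcal{H}$-colorings of $G$. *)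

theory Defs
  imports Complex_Main "HOL-Library.Disjoint_Sets" "Graph_Theory.Graph_Theory"
begin

text \<open>
  A finite simple graph is a \<^typ>\<open>'a pair_pre_digraph\<close> satisfying \<^const>\<open>pair_graph\<close> (finite,
  symmetric, loop-free); an undirected edge $uv$ is the pair of arcs \<open>(u,v)\<close>, \<open>(v,u)\<close>.
\<close>

text \<open>Only meant for \<open>n \<ge> 3\<close>.\<close>

definition cycle_graph :: "nat \<Rightarrow> nat pair_pre_digraph" where
  "cycle_graph n = \<lparr> pverts = {..<n},
     parcs = {(i, j). i < n \<and> j < n \<and> (j = Suc i mod n \<or> i = Suc j mod n)} \<rparr>"

definition complete_bipartite_graph :: "nat \<Rightarrow> nat \<Rightarrow> (nat + nat) pair_pre_digraph" where
  "complete_bipartite_graph k t = \<lparr> pverts = {..<k} <+> {..<t},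
     parcs = (Inl ` {..<k}) \<times> (Inr ` {..<t}) \<union> (Inr ` {..<t}) \<times> (Inl ` {..<k}) \<rparr>"

definition cartesian_product ::
    "'a pair_pre_digraph \<Rightarrow> 'b pair_pre_digraph \<Rightarrow> ('a \<times> 'b) pair_pre_digraph"
    (infixr "\<box>" 70) where
  "G \<box> H = \<lparr> pverts = pverts G \<times> pverts H,
     parcs = {((u, v), (u', v')).
        (u = u' \<and> u \<in> pverts G \<and> (v, v') \<in> parcs H) \<or>
        (v = v' \<and> v \<in> pverts H \<and> (u, u') \<in> parcs G)} \<rparr>"

text \<open>
  The parts \<open>L v\<close> form an indexed partition of the vertices of \<open>H\<close>. Empty parts are not
  excluded, so that the only \<open>0\<close>-fold cover is the empty one (rather than there being none).
  The matching condition is stated from the side of \<open>L u\<close>; the other side is the instance for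
  the reverse arc \<open>(v, u)\<close>.
\<close>

definition is_cover :: "'a pair_pre_digraph \<Rightarrow> ('a \<Rightarrow> 'b set) \<Rightarrow> 'b pair_pre_digraph \<Rightarrow> bool" where
  "is_cover G L H \<longleftrightarrow>
     pair_graph H \<and>
     (\<Union>v\<in>pverts G. L v) = pverts H \<and>
     disjoint_family_on L (pverts G) \<and>
     (\<forall>v\<in>pverts G. \<forall>x\<in>L v. \<forall>y\<in>L v. x \<noteq> y \<longrightarrow> (x, y) \<in> parcs H) \<and>
     (\<forall>u\<in>pverts G. \<forall>v\<in>pverts G. \<forall>x\<in>L u. \<forall>y\<in>L v.
        u \<noteq> v \<and> (x, y) \<in> parcs H \<longrightarrow> (u, v) \<in> parcs G) \<and>
     (\<forall>(u, v)\<in>parcs G. \<forall>x\<in>L u. \<forall>y\<in>L v. \<forall>z\<in>L v.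
        (x, y) \<in> parcs H \<and> (x, z) \<in> parcs H \<longrightarrow> y = z)"

definition is_fold_cover ::
    "nat \<Rightarrow> 'a pair_pre_digraph \<Rightarrow> ('a \<Rightarrow> 'b set) \<Rightarrow> 'b pair_pre_digraph \<Rightarrow> bool" where
  "is_fold_cover m G L H \<longleftrightarrow> is_cover G L H \<and> (\<forall>v\<in>pverts G. card (L v) = m)"

definition independent_set :: "'b pair_pre_digraph \<Rightarrow> 'b set \<Rightarrow> bool" where
  "independent_set H I \<longleftrightarrow> I \<subseteq> pverts H \<and> (\<forall>x\<in>I. \<forall>y\<in>I. (x, y) \<notin> parcs H)"

text \<open>A colouring does not depend on \<open>L\<close>, only on \<open>H\<close> and the order of \<open>G\<close>.\<close>

definition cover_colorings :: "'a pair_pre_digraph \<Rightarrow> 'b pair_pre_digraph \<Rightarrow> 'b set set" where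
  "cover_colorings G H = {I. independent_set H I \<and> card I = card (pverts G)}"

text \<open>
  In the next two definitions the vertices of \<open>H\<close> are natural numbers. This loses nothing,
  since \<open>H\<close> is finite: see \<open>fold_cover_nat\<close> below.
\<close>

definition dp_chromatic_number :: "'a pair_pre_digraph \<Rightarrow> nat" where
  "dp_chromatic_number G = (LEAST m. \<forall>(L :: 'a \<Rightarrow> nat set) H.
     is_fold_cover m G L H \<longrightarrow> cover_colorings G H \<noteq> {})"

definition dp_color_function :: "'a pair_pre_digraph \<Rightarrow> nat \<Rightarrow> nat" where
  "dp_color_function G m = (LEAST n. \<exists>(L :: 'a \<Rightarrow> nat set) H.
     is_fold_cover m G L H \<and> n = card (cover_colorings G H))"

definition dp_const :: "nat \<Rightarrow> int" where
  "dp_const k = (if k = 1 then 1 else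
     \<lceil>real k * ln (real k + 2) /
       (ln 2 + (real k - 1) * ln (real k + 2)
          - ln (2 * (real k + 2) ^ (k - 1) - fact (k + 1)))\<rceil>)"

lemma pair_graphI:
  assumes "finite (pverts G)" "parcs G \<subseteq> pverts G \<times> pverts G"
    and "sym (parcs G)" "irrefl (parcs G)"
  shows "pair_graph G"
proof -
  have "finite (parcs G)"
    using assms(1,2) finite_subset by blast
  then show ?thesis
    using assms by unfold_locales (auto simp: symmetric_def irrefl_def)
qed

lemma pair_graph_cycle_graph: "n \<ge> 3 \<Longrightarrow> pair_graph (cycle_graph n)"
proof (rule pair_graphI)
  assume n: "n \<ge> 3"
  have "Suc i mod n \<noteq> i" if "i < n" for i
    using n that by (auto simp: mod_Suc)
  then show "irrefl (parcs (cycle_graph n))"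
    by (fastforce simp: irrefl_def cycle_graph_def)
qed (auto simp: cycle_graph_def sym_def)

lemma pair_graph_complete_bipartite_graph: "pair_graph (complete_bipartite_graph k t)"
  by (rule pair_graphI) (auto simp: complete_bipartite_graph_def sym_def irrefl_def)

lemma complete_bipartite_graph: "K\<^bsub>k,t\<^esub> (with_proj (complete_bipartite_graph k t))"
proof -
  have "graph (with_proj (complete_bipartite_graph k t))"
    using pair_graph_complete_bipartite_graph by (rule pair_graph.pair_graphD_graph)
  moreover have "card (Inl ` {..<k} :: (nat + nat) set) = k" "card (Inr ` {..<t} :: (nat + nat) set) = t"
    by (simp_all add: card_image)
  ultimately show ?thesis
    unfolding complete_bipartite_digraph_def
    by (intro conjI exI[of _ "Inl ` {..<k}"] exI[of _ "Inr ` {..<t}"])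
       (auto simp: complete_bipartite_graph_def)
qed

lemma pair_graph_cartesian_product:
  assumes "pair_graph G" "pair_graph H"
  shows "pair_graph (G \<box> H)"
proof -
  interpret G: pair_graph G by fact
  interpret H: pair_graph H by fact
  have s: "sym (parcs G)" "sym (parcs H)"
    using G.pair_sym_arcs H.pair_sym_arcs by (auto simp: symmetric_def)
  show ?thesis
  proof (rule pair_graphI)
    show "finite (pverts (G \<box> H))"
      by (simp add: cartesian_product_def G.pair_finite_verts H.pair_finite_verts)
    show "parcs (G \<box> H) \<subseteq> pverts (G \<box> H) \<times> pverts (G \<box> H)"
      by (auto simp: cartesian_product_def dest: G.wellformed' H.wellformed')
    show "sym (parcs (G \<box> H))"
      using s unfolding cartesian_product_def sym_def by auto
    show "irrefl (parcs (G \<box> H))"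
      using G.pair_no_loops H.pair_no_loops
      by (fastforce simp: irrefl_def cartesian_product_def)
  qed
qed

lemma fold_cover_nat:
  fixes L :: "'a \<Rightarrow> 'b set"
  assumes "pair_graph G" "is_fold_cover m G L H"
  shows "\<exists>(L' :: 'a \<Rightarrow> nat set) H'. is_fold_cover m G L' H' \<and>
           (\<exists>\<phi>. bij_betw \<phi> (cover_colorings G H) (cover_colorings G H'))"
proof -
  have cov: "is_cover G L H" and m: "\<forall>v\<in>pverts G. card (L v) = m"
    using assms by (auto simp: is_fold_cover_def)
  have clique: "(x, y) \<in> parcs H" if "v \<in> pverts G" "x \<in> L v" "y \<in> L v" "x \<noteq> y" for v x y
    using cov that by (simp add: is_cover_def)
  have matching: "y = z" if "(u, v) \<in> parcs G" "x \<in> L u" "y \<in> L v" "z \<in> L v"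
      "(x, y) \<in> parcs H" "(x, z) \<in> parcs H" for u v x y z
  proof -
    have "\<forall>(u, v)\<in>parcs G. \<forall>x\<in>L u. \<forall>y\<in>L v. \<forall>z\<in>L v.
        (x, y) \<in> parcs H \<and> (x, z) \<in> parcs H \<longrightarrow> y = z"
      using cov by (simp add: is_cover_def)
    then show ?thesis using that by blast
  qed
  interpret G: pair_graph G by fact
  interpret H: pair_graph H using cov by (simp add: is_cover_def)
  obtain f :: "'b \<Rightarrow> nat" where f: "inj_on f (pverts H)"
    using H.pair_finite_verts finite_imp_inj_to_nat_seg by metis
  have LH: "L v \<subseteq> pverts H" if "v \<in> pverts G" for v
    using cov that by (auto simp: is_cover_def)
  define H' where "H' = \<lparr> pverts = f ` pverts H, parcs = map_prod f f ` parcs H \<rparr>"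
  define L' where "L' v = f ` L v" for v
  have fe: "f x = f y \<longleftrightarrow> x = y" if "x \<in> pverts H" "y \<in> pverts H" for x y
    using f that by (auto simp: inj_on_eq_iff)
  have arc: "(f x, f y) \<in> parcs H' \<longleftrightarrow> (x, y) \<in> parcs H"
    if "x \<in> pverts H" "y \<in> pverts H" for x y
  proof
    assume "(f x, f y) \<in> parcs H'"
    then obtain a b where ab: "(a, b) \<in> parcs H" "f x = f a" "f y = f b"
      by (auto simp: H'_def)
    then have "a = x" "b = y" using fe[of x a] fe[of y b] that H.wellformed' by auto
    with ab show "(x, y) \<in> parcs H" by simp
  qed (force simp: H'_def)
  have "pair_graph H'"
  proof (rule pair_graphI)
    show "sym (parcs H')"
      using H.pair_sym_arcs unfolding H'_def symmetric_def sym_def by force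
    show "irrefl (parcs H')"
      unfolding irrefl_def
    proof (intro allI notI)
      fix z assume "(z, z) \<in> parcs H'"
      then obtain a b where ab: "(a, b) \<in> parcs H" "f a = f b"
        by (auto simp: H'_def)
      then have "a = b" using fe H.wellformed' by metis
      then show False using H.pair_no_loops ab(1) by fastforce
    qed
  qed (use H.pair_finite_verts H.wellformed' in \<open>auto simp: H'_def\<close>)
  moreover have "(\<Union>v\<in>pverts G. L' v) = pverts H'"
    using cov by (simp add: is_cover_def L'_def H'_def flip: image_UN)
  moreover have "disjoint_family_on L' (pverts G)"
    unfolding disjoint_family_on_def
  proof (intro ballI impI)
    fix u v assume uv: "u \<in> pverts G" "v \<in> pverts G" "u \<noteq> v"
    then have "L u \<inter> L v = {}" using cov by (auto simp: is_cover_def disjoint_family_on_def)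
    then show "L' u \<inter> L' v = {}"
      using inj_on_image_Int[OF f LH LH] uv by (simp add: L'_def flip: inj_on_image_Int[OF f LH LH])
  qed
  moreover have "\<forall>v\<in>pverts G. \<forall>x\<in>L' v. \<forall>y\<in>L' v. x \<noteq> y \<longrightarrow> (x, y) \<in> parcs H'"
  proof (intro ballI impI)
    fix v x y assume *: "v \<in> pverts G" "x \<in> L' v" "y \<in> L' v" "x \<noteq> y"
    then obtain a b where ab: "a \<in> L v" "b \<in> L v" "x = f a" "y = f b" by (auto simp: L'_def)
    then have "(a, b) \<in> parcs H" using * clique by blast
    then show "(x, y) \<in> parcs H'" using * ab LH arc by blast
  qed
  moreover have "\<forall>u\<in>pverts G. \<forall>v\<in>pverts G. \<forall>x\<in>L' u. \<forall>y\<in>L' v.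
      u \<noteq> v \<and> (x, y) \<in> parcs H' \<longrightarrow> (u, v) \<in> parcs G"
  proof (intro ballI impI)
    fix u v x y
    assume *: "u \<in> pverts G" "v \<in> pverts G" "x \<in> L' u" "y \<in> L' v" "u \<noteq> v \<and> (x, y) \<in> parcs H'"
    then obtain a b where ab: "a \<in> L u" "b \<in> L v" "x = f a" "y = f b" by (auto simp: L'_def)
    then have "(a, b) \<in> parcs H" using * LH arc by blast
    then show "(u, v) \<in> parcs G" using cov * ab unfolding is_cover_def by blast
  qed
  moreover have "\<forall>(u, v)\<in>parcs G. \<forall>x\<in>L' u. \<forall>y\<in>L' v. \<forall>z\<in>L' v.
      (x, y) \<in> parcs H' \<and> (x, z) \<in> parcs H' \<longrightarrow> y = z"
  proof clarify
    fix u v x y z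
    assume *: "(u, v) \<in> parcs G" "x \<in> L' u" "y \<in> L' v" "z \<in> L' v"
      "(x, y) \<in> parcs H'" "(x, z) \<in> parcs H'"
    then obtain a b c where abc: "a \<in> L u" "b \<in> L v" "c \<in> L v" "x = f a" "y = f b" "z = f c"
      by (auto simp: L'_def)
    have "(a, b) \<in> parcs H" "(a, c) \<in> parcs H"
      using * abc LH arc G.wellformed' by (metis subsetD)+
    then have "b = c" using matching *(1) abc by blast
    then show "y = z" using abc by simp
  qed
  ultimately have "is_cover G L' H'" by (simp add: is_cover_def)
  moreover have "\<forall>v\<in>pverts G. card (L' v) = m"
    using m LH f by (auto simp: L'_def card_image inj_on_subset)
  moreover have "bij_betw ((`) f) (cover_colorings G H) (cover_colorings G H')"
    unfolding bij_betw_def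
  proof
    have sub: "cover_colorings G H \<subseteq> Pow (pverts H)"
      by (auto simp: cover_colorings_def independent_set_def)
    show "inj_on ((`) f) (cover_colorings G H)"
      using inj_on_image_Pow[OF f] sub by (rule inj_on_subset)
    have ind: "f ` I \<in> cover_colorings G H' \<longleftrightarrow> I \<in> cover_colorings G H" if I: "I \<subseteq> pverts H" for I
    proof -
      have "card (f ` I) = card I" using f I by (meson card_image inj_on_subset)
      moreover have "f ` I \<subseteq> pverts H'" using I by (auto simp: H'_def)
      moreover have "(f x, f y) \<in> parcs H' \<longleftrightarrow> (x, y) \<in> parcs H" if "x \<in> I" "y \<in> I" for x y
        using I that arc by blast
      ultimately show ?thesis
        using I by (simp add: cover_colorings_def independent_set_def)
    qed
    show "(`) f ` cover_colorings G H = cover_colorings G H'"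
    proof (intro equalityI subsetI)
      fix J assume "J \<in> (`) f ` cover_colorings G H"
      then show "J \<in> cover_colorings G H'" using ind sub by auto
    next
      fix J assume J: "J \<in> cover_colorings G H'"
      then have "J \<subseteq> f ` pverts H"
        by (auto simp: cover_colorings_def independent_set_def H'_def)
      then obtain I where "I \<subseteq> pverts H" "J = f ` I" by (auto simp: subset_image_iff)
      then show "J \<in> (`) f ` cover_colorings G H" using ind J by blast
    qed
  qed
  ultimately show ?thesis unfolding is_fold_cover_def by blast
qed

end

theory Submission
  imports Defs
begin

text \<open>
  The upper bound is greedy: in every induced subgraph of \<open>C \<box> K\<close> either some vertex of the
  \<open>t\<close>-side is left, and it has degree at most \<open>k + 2\<close>, or all degrees are at most \<open>2\<close>.

  For the lower bound let \<open>q = k + 2\<close>, and let all copies of \<open>C\<close> carry the trivial cover, so that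
  they are properly coloured by residues modulo \<open>q\<close>. Adding constants splits the \<open>P\<close> proper
  colourings of \<open>C\<close> into \<open>P/q\<close> classes, each with a unique representative vanishing at vertex
  \<open>0\<close>. A copy on the \<open>t\<close>-side is attached according to representatives \<open>r\<^sub>1, \<dots>, r\<^sub>k\<close> and shifts
  \<open>a\<^sub>1, \<dots>, a\<^sub>k\<close> in such a way that the colourings \<open>r\<^sub>i + s\<^sub>i\<close> of the \<open>k\<close>-side forbid precisely
  the colours \<open>s\<^sub>i + a\<^sub>i\<close> at each of its vertices. If these are distinct, the same two colours
  remain everywhere, and an odd cycle is not 2-colourable. A fraction
  \<open>(k + 1)!/(2 (k + 2)\<^sup>k\<^sup>-\<^sup>1)\<close> of the shift vectors \<open>a\<close> makes them distinct for a given \<open>s\<close>, so a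
  greedy choice of \<open>c\<^sub>k\<close> shift vectors deals with all \<open>s\<close>, and this is done for each of the
  \<open>(P/q)\<^sup>k\<close> tuples of representatives.
\<close>

subsection \<open>Colourings as independent transversals\<close>

text \<open>Only arcs of \<open>G\<close> are tested, since different parts carry edges of
  \<open>H\<close> only along them. \<open>PiE\<close> fixes the values outside
  \<open>pverts G\<close>, so distinct functions have distinct images.\<close>

definition transversal_colorings ::
    "'a pair_pre_digraph \<Rightarrow> ('a \<Rightarrow> 'b set) \<Rightarrow> 'b pair_pre_digraph \<Rightarrow> ('a \<Rightarrow> 'b) set" where
  "transversal_colorings G L H =
     {f \<in> Pi\<^sub>E (pverts G) L. \<forall>(u, v)\<in>parcs G. (f u, f v) \<notin> parcs H}"

lemma
  assumes "is_cover G L H"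
  shows is_cover_pair_graph: "pair_graph H"
    and is_cover_verts: "(\<Union>v\<in>pverts G. L v) = pverts H"
    and is_cover_disjoint:
      "\<And>u v x. \<lbrakk>u \<in> pverts G; v \<in> pverts G; x \<in> L u; x \<in> L v\<rbrakk> \<Longrightarrow> u = v"
    and is_cover_clique:
      "\<And>v x y. \<lbrakk>v \<in> pverts G; x \<in> L v; y \<in> L v; x \<noteq> y\<rbrakk> \<Longrightarrow> (x, y) \<in> parcs H"
    and is_cover_edge: "\<And>u v x y. \<lbrakk>u \<in> pverts G; v \<in> pverts G; x \<in> L u; y \<in> L v; u \<noteq> v;
      (x, y) \<in> parcs H\<rbrakk> \<Longrightarrow> (u, v) \<in> parcs G"
    and is_cover_matching: "\<And>u v x y z. \<lbrakk>(u, v) \<in> parcs G; x \<in> L u; y \<in> L v; z \<in> L v;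
      (x, y) \<in> parcs H; (x, z) \<in> parcs H\<rbrakk> \<Longrightarrow> y = z"
proof -
  show "pair_graph H" "(\<Union>v\<in>pverts G. L v) = pverts H"
    using assms by (simp_all add: is_cover_def)
  have "disjoint_family_on L (pverts G)"
    using assms by (simp add: is_cover_def)
  then show "u = v" if "u \<in> pverts G" "v \<in> pverts G" "x \<in> L u" "x \<in> L v" for u v x
    using that unfolding disjoint_family_on_def by blast
  show "(x, y) \<in> parcs H" if "v \<in> pverts G" "x \<in> L v" "y \<in> L v" "x \<noteq> y" for v x y
    using assms that by (simp add: is_cover_def)
  have "\<forall>u\<in>pverts G. \<forall>v\<in>pverts G. \<forall>x\<in>L u. \<forall>y\<in>L v.
      u \<noteq> v \<and> (x, y) \<in> parcs H \<longrightarrow> (u, v) \<in> parcs G"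
    using assms unfolding is_cover_def by (elim conjE)
  then show "(u, v) \<in> parcs G" if "u \<in> pverts G" "v \<in> pverts G" "x \<in> L u" "y \<in> L v" "u \<noteq> v"
      "(x, y) \<in> parcs H" for u v x y
    using that by blast
  have "\<forall>(u, v)\<in>parcs G. \<forall>x\<in>L u. \<forall>y\<in>L v. \<forall>z\<in>L v.
      (x, y) \<in> parcs H \<and> (x, z) \<in> parcs H \<longrightarrow> y = z"
    using assms unfolding is_cover_def by (elim conjE)
  then show "y = z" if "(u, v) \<in> parcs G" "x \<in> L u" "y \<in> L v" "z \<in> L v"
      "(x, y) \<in> parcs H" "(x, z) \<in> parcs H" for u v x y z
    using that by blast
qed

text \<open>Parts are cliques, so an independent set meets each part at most once; having
  \<open>card (pverts G)\<close> elements, it meets each part exactly once.\<close>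

lemma bij_betw_cover_colorings:
  assumes "pair_graph G" and cov: "is_cover G L H"
  shows "bij_betw (\<lambda>f. f ` pverts G) (transversal_colorings G L H) (cover_colorings G H)"
proof -
  interpret G: pair_graph G by fact
  interpret H: pair_graph H using is_cover_pair_graph[OF cov] .
  note dis = is_cover_disjoint[OF cov]
  have LH: "L v \<subseteq> pverts H" if "v \<in> pverts G" for v
    using is_cover_verts[OF cov] that by blast
  have loop: "(x, x) \<notin> parcs H" for x
    using H.pair_no_loops by fastforce
  have inj: "inj_on f (pverts G)" if "f \<in> Pi\<^sub>E (pverts G) L" for f
    using that dis by (intro inj_onI) (metis PiE_mem)
  show ?thesis
    unfolding bij_betw_def
  proof (intro conjI equalityI subsetI)
    show "inj_on (\<lambda>f. f ` pverts G) (transversal_colorings G L H)"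
    proof (rule inj_onI)
      fix f g assume "f \<in> transversal_colorings G L H" "g \<in> transversal_colorings G L H"
        and eq: "f ` pverts G = g ` pverts G"
      then have f: "f \<in> Pi\<^sub>E (pverts G) L" and g: "g \<in> Pi\<^sub>E (pverts G) L"
        by (auto simp: transversal_colorings_def)
      show "f = g"
      proof (rule PiE_ext[OF f g])
        fix v assume v: "v \<in> pverts G"
        then obtain w where w: "w \<in> pverts G" "f v = g w" using eq by blast
        then have "v = w" using dis[of v w "f v"] v PiE_mem[OF f v] PiE_mem[OF g w(1)] by simp
        then show "f v = g v" using w by simp
      qed
    qed
  next
    fix I assume "I \<in> (\<lambda>f. f ` pverts G) ` transversal_colorings G L H"
    then obtain f where f: "f \<in> Pi\<^sub>E (pverts G) L"
      and ind: "\<forall>(u, v)\<in>parcs G. (f u, f v) \<notin> parcs H" and I: "I = f ` pverts G"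
      by (auto simp: transversal_colorings_def)
    have "(f u, f v) \<notin> parcs H" if "u \<in> pverts G" "v \<in> pverts G" for u v
    proof (cases "u = v")
      case True then show ?thesis using loop by simp
    next
      case False
      then show ?thesis
        using is_cover_edge[OF cov that, of "f u" "f v"] ind that PiE_mem[OF f] by blast
    qed
    moreover have "f ` pverts G \<subseteq> pverts H" using f LH by blast
    moreover have "card (f ` pverts G) = card (pverts G)" using inj[OF f] by (rule card_image)
    ultimately show "I \<in> cover_colorings G H"
      by (auto simp: I cover_colorings_def independent_set_def)
  next
    fix I assume "I \<in> cover_colorings G H"
    then have sub: "I \<subseteq> pverts H" and ind: "\<And>x y. x \<in> I \<Longrightarrow> y \<in> I \<Longrightarrow> (x, y) \<notin> parcs H"
      and card: "card I = card (pverts G)"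
      by (auto simp: cover_colorings_def independent_set_def)
    have "\<forall>x\<in>I. \<exists>v\<in>pverts G. x \<in> L v" using sub is_cover_verts[OF cov] by blast
    then obtain w where w: "\<And>x. x \<in> I \<Longrightarrow> w x \<in> pverts G \<and> x \<in> L (w x)" by metis
    have "inj_on w I"
      using w ind is_cover_clique[OF cov] by (intro inj_onI) metis
    then have "card (w ` I) = card (pverts G)" using card by (simp add: card_image)
    then have surj: "w ` I = pverts G"
      using w by (intro card_subset_eq G.pair_finite_verts) auto
    define f where "f = restrict (inv_into I w) (pverts G)"
    have fw: "f v \<in> I" "w (f v) = v" if "v \<in> pverts G" for v
      using that surj by (auto simp: f_def inv_into_into f_inv_into_f)
    have "f \<in> Pi\<^sub>E (pverts G) L"
    proof (rule PiE_I)
      show "f v \<in> L v" if "v \<in> pverts G" for v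
        using w[of "f v"] fw[OF that] by simp
    qed (simp add: f_def)
    moreover have "\<forall>(u, v)\<in>parcs G. (f u, f v) \<notin> parcs H"
      using fw ind G.wellformed' by blast
    moreover have "f ` pverts G = I"
      using surj \<open>inj_on w I\<close> fw(1) by (auto simp: f_def inv_into_f_f intro!: image_eqI)
    ultimately show "I \<in> (\<lambda>f. f ` pverts G) ` transversal_colorings G L H"
      by (auto simp: transversal_colorings_def)
  qed
qed

lemma card_cover_colorings:
  assumes "pair_graph G" "is_cover G L H"
  shows "card (cover_colorings G H) = card (transversal_colorings G L H)"
  using bij_betw_same_card[OF bij_betw_cover_colorings[OF assms]] by simp

lemma cover_colorings_empty_iff:
  assumes "pair_graph G" "is_cover G L H"
  shows "cover_colorings G H = {} \<longleftrightarrow> transversal_colorings G L H = {}"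
  using bij_betw_cover_colorings[OF assms] by (auto simp: bij_betw_def)

section \<open>Greedy colouring of degenerate graphs, and shrinking covers\<close>

text \<open>Induction over \<open>W\<close>: remove a vertex of degree below \<open>q\<close>,
  colour the rest and put the vertex back. Each neighbour forbids at most one of its
  \<open>q\<close> candidates.\<close>

lemma degenerate_imp_cover_colorable:
  assumes "pair_graph G" and cov: "is_fold_cover q G L H"
    and deg: "\<And>W. W \<subseteq> pverts G \<Longrightarrow> W \<noteq> {} \<Longrightarrow> \<exists>v\<in>W. card {u \<in> W. (u, v) \<in> parcs G} < q"
  shows "cover_colorings G H \<noteq> {}"
proof -
  interpret G: pair_graph G by fact
  have c: "is_cover G L H" and q: "\<And>v. v \<in> pverts G \<Longrightarrow> card (L v) = q"
    using cov by (auto simp: is_fold_cover_def)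
  interpret H: pair_graph H using is_cover_pair_graph[OF c] .
  have Gsym: "(u, v) \<in> parcs G \<Longrightarrow> (v, u) \<in> parcs G" for u v
    using G.pair_sym_arcs by (auto simp: symmetric_def sym_def)
  have Hsym: "(u, v) \<in> parcs H \<Longrightarrow> (v, u) \<in> parcs H" for u v
    using H.pair_sym_arcs by (auto simp: symmetric_def sym_def)
  have Gloop: "(u, u) \<notin> parcs G" for u
    using G.pair_no_loops by fastforce
  have "\<exists>f. (\<forall>v\<in>W. f v \<in> L v) \<and> (\<forall>u\<in>W. \<forall>v\<in>W. (u, v) \<in> parcs G \<longrightarrow> (f u, f v) \<notin> parcs H)"
    if "W \<subseteq> pverts G" for W
  proof -
    have "finite W" using that G.pair_finite_verts finite_subset by blast
    then show ?thesis
      using that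
    proof (induction W rule: finite_psubset_induct)
      case (psubset W)
      show ?case
      proof (cases "W = {}")
        case False
        then obtain v where v: "v \<in> W" and d: "card {u \<in> W. (u, v) \<in> parcs G} < q"
          using deg psubset.prems by blast
        have "W - {v} \<subset> W" using v by blast
        from psubset.IH[OF this] psubset.prems obtain f
          where f: "\<And>u. u \<in> W - {v} \<Longrightarrow> f u \<in> L u"
            "\<And>u w. u \<in> W - {v} \<Longrightarrow> w \<in> W - {v} \<Longrightarrow> (u, w) \<in> parcs G \<Longrightarrow> (f u, f w) \<notin> parcs H"
          by blast
        define N where "N = {u \<in> W. (u, v) \<in> parcs G}"
        define B where "B = {y \<in> L v. \<exists>u\<in>N. (f u, y) \<in> parcs H}"
        have Nv: "u \<in> W - {v}" if "u \<in> N" for u using that Gloop by (auto simp: N_def)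
        \<comment> \<open>\<open>g\<close> charges each forbidden candidate to a coloured neighbour.
          The matching condition makes \<open>g\<close> injective, so \<open>B\<close> is no larger
          than \<open>N\<close>.\<close>
        have "\<forall>y\<in>B. \<exists>u. u \<in> N \<and> (f u, y) \<in> parcs H" by (auto simp: B_def)
        then obtain g where g: "\<And>y. y \<in> B \<Longrightarrow> g y \<in> N \<and> (f (g y), y) \<in> parcs H" by metis
        have "inj_on g B"
        proof (rule inj_onI)
          fix y z assume yz: "y \<in> B" "z \<in> B" "g y = g z"
          show "y = z"
          proof (rule is_cover_matching[OF c])
            show "(g y, v) \<in> parcs G" using g[OF yz(1)] by (simp add: N_def)
            show "f (g y) \<in> L (g y)" using g[OF yz(1)] Nv f(1) by blast
          qed (use yz g[OF yz(1)] g[OF yz(2)] in \<open>auto simp: B_def\<close>)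
        qed
        moreover have "finite N" using psubset.hyps by (simp add: N_def)
        ultimately have "card B \<le> card N" using g by (intro card_inj_on_le) auto
        also have "\<dots> < card (L v)" using d q v psubset.prems by (auto simp: N_def)
        finally have "card B < card (L v)" .
        moreover have "B \<subseteq> L v" by (auto simp: B_def)
        ultimately obtain y where y: "y \<in> L v" "y \<notin> B" by (metis nat_neq_iff subsetI subset_antisym)
        have new: "(f u, y) \<notin> parcs H" "(y, f u) \<notin> parcs H"
          if "u \<in> W" "(u, v) \<in> parcs G" for u
          using y that Hsym by (auto simp: B_def N_def)
        have "\<forall>u\<in>W. (f(v := y)) u \<in> L u" using f(1) y by simp
        moreover have "\<forall>u\<in>W. \<forall>w\<in>W. (u, w) \<in> parcs G \<longrightarrow> ((f(v := y)) u, (f(v := y)) w) \<notin> parcs H"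
          using f(2) new Gloop Gsym by auto
        ultimately show ?thesis by blast
      qed simp
    qed
  qed
  from this[OF subset_refl] obtain f where f: "\<forall>v\<in>pverts G. f v \<in> L v"
    "\<forall>u\<in>pverts G. \<forall>v\<in>pverts G. (u, v) \<in> parcs G \<longrightarrow> (f u, f v) \<notin> parcs H"
    by blast
  then have "restrict f (pverts G) \<in> transversal_colorings G L H"
    unfolding transversal_colorings_def using G.wellformed' by (auto simp: restrict_def)
  then show ?thesis using cover_colorings_empty_iff[OF \<open>pair_graph G\<close> c] by blast
qed

text \<open>A colouring of the cover cut down to \<open>p\<close> vertices per part also colours the
  original. This is needed because minimality in \<open>dp_chromatic_number\<close> must exclude
  every smaller fold number.\<close>

lemma fold_cover_subfold_uncolorable:
  fixes L :: "'a \<Rightarrow> 'b set"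
  assumes "pair_graph G" "is_fold_cover q G L H" "p \<le> q" and empty: "cover_colorings G H = {}"
  shows "\<exists>(L' :: 'a \<Rightarrow> 'b set) H'. is_fold_cover p G L' H' \<and> cover_colorings G H' = {}"
proof -
  have c: "is_cover G L H" and q: "\<And>v. v \<in> pverts G \<Longrightarrow> card (L v) = q"
    using assms by (auto simp: is_fold_cover_def)
  interpret G: pair_graph G by fact
  interpret H: pair_graph H using is_cover_pair_graph[OF c] .
  have "\<forall>v. \<exists>S. v \<in> pverts G \<longrightarrow> S \<subseteq> L v \<and> card S = p"
    using q \<open>p \<le> q\<close> by (metis obtain_subset_with_card_n)
  then obtain L' where L': "\<And>v. v \<in> pverts G \<Longrightarrow> L' v \<subseteq> L v \<and> card (L' v) = p" by metis
  define U where "U = (\<Union>v\<in>pverts G. L' v)"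
  define H' where "H' = \<lparr>pverts = U, parcs = parcs H \<inter> U \<times> U\<rparr>"
  have U: "U \<subseteq> pverts H" using L' is_cover_verts[OF c] by (fastforce simp: U_def)
  have "pair_graph H'"
  proof (rule pair_graphI)
    show "sym (parcs H')"
      using H.pair_sym_arcs by (auto simp: H'_def symmetric_def sym_def)
    show "irrefl (parcs H')"
      using H.pair_no_loops by (fastforce simp: H'_def irrefl_def)
    show "finite (pverts H')" using finite_subset[OF U H.pair_finite_verts] by (simp add: H'_def)
  qed (simp add: H'_def)
  moreover have "disjoint_family_on L' (pverts G)"
    using is_cover_disjoint[OF c] L' unfolding disjoint_family_on_def by blast
  moreover have "\<forall>v\<in>pverts G. \<forall>x\<in>L' v. \<forall>y\<in>L' v. x \<noteq> y \<longrightarrow> (x, y) \<in> parcs H'"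
    using is_cover_clique[OF c] L' by (fastforce simp: H'_def U_def)
  moreover have "\<forall>u\<in>pverts G. \<forall>v\<in>pverts G. \<forall>x\<in>L' u. \<forall>y\<in>L' v.
        u \<noteq> v \<and> (x, y) \<in> parcs H' \<longrightarrow> (u, v) \<in> parcs G"
  proof (intro ballI impI)
    fix u v x y
    assume *: "u \<in> pverts G" "v \<in> pverts G" "x \<in> L' u" "y \<in> L' v" "u \<noteq> v \<and> (x, y) \<in> parcs H'"
    show "(u, v) \<in> parcs G"
      by (rule is_cover_edge[OF c *(1,2)]) (use * L' in \<open>auto simp: H'_def\<close>)
  qed
  moreover have "\<forall>(u, v)\<in>parcs G. \<forall>x\<in>L' u. \<forall>y\<in>L' v. \<forall>z\<in>L' v.
        (x, y) \<in> parcs H' \<and> (x, z) \<in> parcs H' \<longrightarrow> y = z"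
  proof clarify
    fix u v x y z
    assume *: "(u, v) \<in> parcs G" "x \<in> L' u" "y \<in> L' v" "z \<in> L' v"
      "(x, y) \<in> parcs H'" "(x, z) \<in> parcs H'"
    have "u \<in> pverts G" "v \<in> pverts G" using G.wellformed' *(1) by auto
    then show "y = z"
      using is_cover_matching[OF c *(1), of x y z] * L' by (auto simp: H'_def)
  qed
  ultimately have "is_fold_cover p G L' H'"
    using L' by (simp add: is_fold_cover_def is_cover_def) (simp add: H'_def U_def)
  moreover have "cover_colorings G H' \<subseteq> cover_colorings G H"
    using U by (fastforce simp: cover_colorings_def independent_set_def H'_def)
  ultimately show ?thesis using empty by blast
qed

section \<open>Covers given by clashes between colours\<close>

text \<open>Vertex \<open>(v, c)\<close> stands for colour \<open>c\<close> at \<open>v\<close>;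
  \<open>M u v c d\<close> means that \<open>c\<close> and \<open>d\<close> clash along the arc
  \<open>(u, v)\<close>.\<close>

definition relation_cover ::
    "'a pair_pre_digraph \<Rightarrow> nat \<Rightarrow> ('a \<Rightarrow> 'a \<Rightarrow> nat \<Rightarrow> nat \<Rightarrow> bool) \<Rightarrow> ('a \<times> nat) pair_pre_digraph" where
  "relation_cover G q M = \<lparr> pverts = pverts G \<times> {..<q},
     parcs = {((u, c), (v, d)). u \<in> pverts G \<and> v \<in> pverts G \<and> c < q \<and> d < q \<and>
        (u = v \<and> c \<noteq> d \<or> (u, v) \<in> parcs G \<and> M u v c d)} \<rparr>"

lemma is_fold_cover_relation_cover:
  assumes "pair_graph G"
    and sym: "\<And>u v c d. (u, v) \<in> parcs G \<Longrightarrow> c < q \<Longrightarrow> d < q \<Longrightarrow> M u v c d \<Longrightarrow> M v u d c"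
    and fn: "\<And>u v c d e. (u, v) \<in> parcs G \<Longrightarrow> c < q \<Longrightarrow> d < q \<Longrightarrow> e < q \<Longrightarrow>
       M u v c d \<Longrightarrow> M u v c e \<Longrightarrow> d = e"
  shows "is_fold_cover q G (\<lambda>v. {v} \<times> {..<q}) (relation_cover G q M)"
proof -
  interpret G: pair_graph G by fact
  have Gsym: "(u, v) \<in> parcs G \<Longrightarrow> (v, u) \<in> parcs G" for u v
    using G.pair_sym_arcs by (auto simp: symmetric_def sym_def)
  have Gloop: "(u, u) \<notin> parcs G" for u
    using G.pair_no_loops by fastforce
  have "pair_graph (relation_cover G q M)"
    by (rule pair_graphI)
       (auto simp: relation_cover_def sym_def irrefl_def G.pair_finite_verts Gloop intro: Gsym sym)
  then show ?thesis
    using fn Gloop by (auto simp: is_fold_cover_def is_cover_def disjoint_family_on_def)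
      (auto simp: relation_cover_def)
qed

text \<open>The first component of a chosen vertex is forced to be \<open>v\<close>, so a selection
  amounts to a plain assignment of colours.\<close>

lemma transversal_colorings_relation_cover:
  assumes "pair_graph G"
  shows "bij_betw (\<lambda>f. restrict (\<lambda>v. (v, f v)) (pverts G))
    {f \<in> pverts G \<rightarrow>\<^sub>E {..<q}. \<forall>(u, v)\<in>parcs G. \<not> M u v (f u) (f v)}
    (transversal_colorings G (\<lambda>v. {v} \<times> {..<q}) (relation_cover G q M))"
proof (rule bij_betw_byWitness[where f' = "\<lambda>g. restrict (\<lambda>v. snd (g v)) (pverts G)"])
  interpret G: pair_graph G by fact
  let ?A = "{f \<in> pverts G \<rightarrow>\<^sub>E {..<q}. \<forall>(u, v)\<in>parcs G. \<not> M u v (f u) (f v)}"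
  let ?B = "transversal_colorings G (\<lambda>v. {v} \<times> {..<q}) (relation_cover G q M)"
  have Gloop: "(u, u) \<notin> parcs G" for u
    using G.pair_no_loops by fastforce
  have fst: "fst (g v) = v" "snd (g v) < q" "g v = (v, snd (g v))"
    if "g \<in> (\<Pi>\<^sub>E v\<in>pverts G. {v} \<times> {..<q})" "v \<in> pverts G" for g v
    using PiE_mem[OF that] by auto
  show "\<forall>f\<in>?A. restrict (\<lambda>v. snd (restrict (\<lambda>v. (v, f v)) (pverts G) v)) (pverts G) = f"
    by (auto simp: fun_eq_iff PiE_iff extensional_def)
  show "\<forall>g\<in>?B. restrict (\<lambda>v. (v, restrict (\<lambda>v. snd (g v)) (pverts G) v)) (pverts G) = g"
  proof
    fix g assume "g \<in> ?B"
    then have g: "g \<in> (\<Pi>\<^sub>E v\<in>pverts G. {v} \<times> {..<q})" by (simp add: transversal_colorings_def)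
    show "restrict (\<lambda>v. (v, restrict (\<lambda>v. snd (g v)) (pverts G) v)) (pverts G) = g"
      using fst(3)[OF g] PiE_arb[OF g] by (auto simp: fun_eq_iff)
  qed
  show "(\<lambda>f. restrict (\<lambda>v. (v, f v)) (pverts G)) ` ?A \<subseteq> ?B"
    using Gloop G.wellformed' by (auto simp: transversal_colorings_def relation_cover_def)
  show "(\<lambda>g. restrict (\<lambda>v. snd (g v)) (pverts G)) ` ?B \<subseteq> ?A"
  proof clarify
    fix g assume "g \<in> ?B"
    then have g: "g \<in> (\<Pi>\<^sub>E v\<in>pverts G. {v} \<times> {..<q})"
      and ind: "\<forall>(u, v)\<in>parcs G. (g u, g v) \<notin> parcs (relation_cover G q M)"
      by (simp_all add: transversal_colorings_def)
    have "\<not> M u v (snd (g u)) (snd (g v))" if uv: "(u, v) \<in> parcs G" for u v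
    proof -
      have "u \<in> pverts G" "v \<in> pverts G" using G.wellformed' uv by auto
      moreover have "((u, snd (g u)), (v, snd (g v))) \<notin> parcs (relation_cover G q M)"
        using ind uv fst(3)[OF g] \<open>u \<in> pverts G\<close> \<open>v \<in> pverts G\<close> by (metis (no_types, lifting) case_prodD)
      ultimately show ?thesis
        using uv fst(2)[OF g] by (simp add: relation_cover_def)
    qed
    moreover have "restrict (\<lambda>v. snd (g v)) (pverts G) \<in> pverts G \<rightarrow>\<^sub>E {..<q}"
      using fst(2)[OF g] by auto
    ultimately show "restrict (\<lambda>v. snd (g v)) (pverts G) \<in> pverts G \<rightarrow>\<^sub>E {..<q} \<and>
       (\<forall>(u, v)\<in>parcs G. \<not> M u v (restrict (\<lambda>v. snd (g v)) (pverts G) u)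
         (restrict (\<lambda>v. snd (g v)) (pverts G) v))"
      using G.wellformed' by (auto split: prod.splits)
  qed
qed

subsection \<open>The DP colour function of odd cycles\<close>

text \<open>With P_i the permutation matrix of \<open>\<sigma> i\<close>, the number of walks is the
  \<open>(a, b)\<close> entry of the product of the matrices J - P_i. \<open>r\<close> counts edges,
  hence \<open>Suc r\<close> values.\<close>

definition walks ::
    "(nat \<Rightarrow> 'b set) \<Rightarrow> (nat \<Rightarrow> 'b \<Rightarrow> 'b) \<Rightarrow> nat \<Rightarrow> 'b \<Rightarrow> 'b \<Rightarrow> (nat \<Rightarrow> 'b) set" where
  "walks L \<sigma> r a b =
     {f \<in> Pi\<^sub>E {..<Suc r} L. f 0 = a \<and> f r = b \<and> (\<forall>i<r. f (Suc i) \<noteq> \<sigma> i (f i))}"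

text \<open>Takes forbidden steps only; around a whole cycle this is the monodromy of the
  cover.\<close>

fun transport :: "(nat \<Rightarrow> 'b \<Rightarrow> 'b) \<Rightarrow> nat \<Rightarrow> 'b \<Rightarrow> 'b" where
  "transport \<sigma> 0 a = a"
| "transport \<sigma> (Suc r) a = \<sigma> r (transport \<sigma> r a)"

text \<open>
  The closed form comes from \<open>(J - P\<^sub>1) \<cdots> (J - P\<^sub>r) = c\<^sub>r J + (-1)\<^sup>r P\<^sub>1 \<cdots> P\<^sub>r\<close> for
  permutation matrices \<open>P\<^sub>i\<close> and the all-ones matrix \<open>J\<close> of order \<open>q\<close>,
  where \<open>q c\<^sub>r = (q - 1)\<^sup>r - (-1)\<^sup>r\<close>.
\<close>

lemma sum_walk_formula:
  fixes w :: "'b \<Rightarrow> nat"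
  assumes S: "finite S" "card S = q" and bij: "bij_betw \<rho> S T" and "x \<in> S" "b \<in> T"
    and w: "\<And>c. c \<in> S \<Longrightarrow> int q * int (w c)
       = (int q - 1) ^ r + (-1) ^ r * (if c = x then int q - 1 else -1)"
  shows "int q * int (\<Sum>c | c \<in> S \<and> \<rho> c \<noteq> b. w c)
       = (int q - 1) ^ Suc r + (-1) ^ Suc r * (if b = \<rho> x then int q - 1 else -1)"
proof -
  \<comment> \<open>\<open>b'\<close> is the only point from which the step to \<open>b\<close> is
    forbidden.\<close>
  obtain b' where b': "b' \<in> S" "\<rho> b' = b" using bij \<open>b \<in> T\<close> by (auto simp: bij_betw_def)
  have inj: "\<rho> c = b \<longleftrightarrow> c = b'" if "c \<in> S" for c
    using bij b' that by (auto simp: bij_betw_def inj_on_eq_iff)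
  have "{c. c \<in> S \<and> \<rho> c \<noteq> b} = S - {b'}" using inj by auto
  then have "(\<Sum>c\<in>S. w c) = (\<Sum>c | c \<in> S \<and> \<rho> c \<noteq> b. w c) + w b'"
    using sum.remove[OF S(1) b'(1), of w] by simp
  then have "int q * int (\<Sum>c | c \<in> S \<and> \<rho> c \<noteq> b. w c)
      = (\<Sum>c\<in>S. int q * int (w c)) - int q * int (w b')"
    by (simp add: distrib_left flip: sum_distrib_left of_nat_sum)
  \<comment> \<open>In this form the signed terms visibly cancel over the \<open>q\<close> points of
    \<open>S\<close>.\<close>
  also have "(\<Sum>c\<in>S. int q * int (w c))
      = (\<Sum>c\<in>S. (int q - 1) ^ r + (-1) ^ r * ((if c = x then int q else 0) - 1))"
    by (intro sum.cong) (auto simp: w)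
  also have "\<dots> = int q * (int q - 1) ^ r"
    using S \<open>x \<in> S\<close> by (simp add: sum.distrib sum_subtractf flip: sum_distrib_left)
  also have "int q * int (w b')
      = (int q - 1) ^ r + (-1) ^ r * (if b = \<rho> x then int q - 1 else -1)"
    using w[OF b'(1)] inj[OF \<open>x \<in> S\<close>] by (auto simp: eq_commute)
  finally show ?thesis by (simp add: algebra_simps)
qed

lemma transport_in:
  assumes "\<And>i. i < r \<Longrightarrow> bij_betw (\<sigma> i) (L i) (L (Suc i))" "a \<in> L 0"
  shows "transport \<sigma> r a \<in> L r"
  using assms
proof (induction r)
  case (Suc r)
  have "transport \<sigma> r a \<in> L r" using Suc.prems by (intro Suc.IH) auto
  then show ?case using bij_betw_apply[OF Suc.prems(1)[of r]] by simp
qed simp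

lemma card_walks:
  assumes L: "\<And>i. i \<le> r \<Longrightarrow> finite (L i)" "\<And>i. i \<le> r \<Longrightarrow> card (L i) = q"
    and \<sigma>: "\<And>i. i < r \<Longrightarrow> bij_betw (\<sigma> i) (L i) (L (Suc i))"
    and a: "a \<in> L 0" and "b \<in> L r"
  shows "int q * int (card (walks L \<sigma> r a b))
       = (int q - 1) ^ r + (-1) ^ r * (if b = transport \<sigma> r a then int q - 1 else -1)"
  using L \<sigma> \<open>b \<in> L r\<close>
proof (induction r arbitrary: b)
  case 0
  have "walks L \<sigma> 0 a b = (if b = a then {\<lambda>i\<in>{..<Suc 0}. a} else {})"
    using a by (auto simp: walks_def PiE_iff extensional_def fun_eq_iff)
  then show ?case by simp
next
  case (Suc r)
  have "bij_betw (\<lambda>f. restrict f {..<Suc r}) (walks L \<sigma> (Suc r) a b)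
      (\<Union>c\<in>{c. c \<in> L r \<and> \<sigma> r c \<noteq> b}. walks L \<sigma> r a c)"
  proof (rule bij_betw_byWitness[where f' = "\<lambda>g. g(Suc r := b)"])
    show "\<forall>f\<in>walks L \<sigma> (Suc r) a b. (restrict f {..<Suc r})(Suc r := b) = f"
      by (auto simp: walks_def PiE_iff extensional_def fun_eq_iff less_Suc_eq)
    show "\<forall>g\<in>\<Union>c\<in>{c. c \<in> L r \<and> \<sigma> r c \<noteq> b}. walks L \<sigma> r a c. restrict (g(Suc r := b)) {..<Suc r} = g"
      by (auto simp: walks_def PiE_iff extensional_def fun_eq_iff)
    show "(\<lambda>f. restrict f {..<Suc r}) ` walks L \<sigma> (Suc r) a b
        \<subseteq> (\<Union>c\<in>{c. c \<in> L r \<and> \<sigma> r c \<noteq> b}. walks L \<sigma> r a c)"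
    proof (clarify, intro UN_I[of "f r" for f])
      fix f assume f: "f \<in> walks L \<sigma> (Suc r) a b"
      then show "f r \<in> {c. c \<in> L r \<and> \<sigma> r c \<noteq> b}"
        by (auto simp: walks_def PiE_iff)
      show "restrict f {..<Suc r} \<in> walks L \<sigma> r a (f r)"
        using f by (auto simp: walks_def PiE_iff)
    qed
    show "(\<lambda>g. g(Suc r := b)) ` (\<Union>c\<in>{c. c \<in> L r \<and> \<sigma> r c \<noteq> b}. walks L \<sigma> r a c)
        \<subseteq> walks L \<sigma> (Suc r) a b"
      using Suc.prems(4) by (auto simp: walks_def PiE_iff extensional_def less_Suc_eq)
  qed
  then have "card (walks L \<sigma> (Suc r) a b)
      = card (\<Union>c\<in>{c. c \<in> L r \<and> \<sigma> r c \<noteq> b}. walks L \<sigma> r a c)"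
    by (rule bij_betw_same_card)
  also have "\<dots> = (\<Sum>c | c \<in> L r \<and> \<sigma> r c \<noteq> b. card (walks L \<sigma> r a c))"
  proof (rule card_UN_disjoint)
    have "finite (Pi\<^sub>E {..<Suc r} L)" using Suc.prems(1) by (intro finite_PiE) auto
    then show "\<forall>c\<in>{c. c \<in> L r \<and> \<sigma> r c \<noteq> b}. finite (walks L \<sigma> r a c)"
      by (auto simp: walks_def)
  qed (use Suc.prems(1) in \<open>auto simp: walks_def\<close>)
  finally have card: "card (walks L \<sigma> (Suc r) a b)
      = (\<Sum>c | c \<in> L r \<and> \<sigma> r c \<noteq> b. card (walks L \<sigma> r a c))" .
  show ?case
    unfolding card transport.simps
  proof (rule sum_walk_formula)
    show "transport \<sigma> r a \<in> L r"
      using Suc.prems(3) a by (intro transport_in) auto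
    show "bij_betw (\<sigma> r) (L r) (L (Suc r))" using Suc.prems(3) by simp
  qed (use Suc.prems Suc.IH in auto)
qed

text \<open>There are as many edges as vertices: the last edge, governed by
  \<open>\<sigma> r\<close>, returns to vertex \<open>0\<close> instead of entering a new
  part.\<close>

definition closed_walks ::
    "(nat \<Rightarrow> 'b set) \<Rightarrow> (nat \<Rightarrow> 'b \<Rightarrow> 'b) \<Rightarrow> nat \<Rightarrow> 'b \<Rightarrow> (nat \<Rightarrow> 'b) set" where
  "closed_walks L \<sigma> r a =
     {f \<in> Pi\<^sub>E {..<Suc r} L. f 0 = a \<and> (\<forall>i<r. f (Suc i) \<noteq> \<sigma> i (f i)) \<and> \<sigma> r (f r) \<noteq> a}"

text \<open>Walks with \<open>r\<close> edges are closed up by one more use of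
  \<open>sum_walk_formula\<close> with the start \<open>a\<close> as target. The signed term depends
  only on whether the monodromy fixes \<open>a\<close>.\<close>

lemma card_closed_walks:
  assumes L: "\<And>i. i \<le> r \<Longrightarrow> finite (L i)" "\<And>i. i \<le> r \<Longrightarrow> card (L i) = q"
    and \<sigma>: "\<And>i. i < r \<Longrightarrow> bij_betw (\<sigma> i) (L i) (L (Suc i))" "bij_betw (\<sigma> r) (L r) (L 0)"
    and a: "a \<in> L 0"
  shows "int q * int (card (closed_walks L \<sigma> r a))
       = (int q - 1) ^ Suc r + (-1) ^ Suc r * (if a = transport \<sigma> (Suc r) a then int q - 1 else -1)"
proof -
  have "closed_walks L \<sigma> r a = (\<Union>b\<in>{b. b \<in> L r \<and> \<sigma> r b \<noteq> a}. walks L \<sigma> r a b)"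
    by (auto simp: closed_walks_def walks_def)
  also have "card \<dots> = (\<Sum>b | b \<in> L r \<and> \<sigma> r b \<noteq> a. card (walks L \<sigma> r a b))"
  proof (rule card_UN_disjoint)
    have "finite (Pi\<^sub>E {..<Suc r} L)" using L(1) by (intro finite_PiE) auto
    then show "\<forall>b\<in>{b. b \<in> L r \<and> \<sigma> r b \<noteq> a}. finite (walks L \<sigma> r a b)"
      by (auto simp: walks_def)
  qed (use L(1) in \<open>auto simp: walks_def\<close>)
  finally have card: "card (closed_walks L \<sigma> r a)
      = (\<Sum>b | b \<in> L r \<and> \<sigma> r b \<noteq> a. card (walks L \<sigma> r a b))" .
  show ?thesis
    unfolding card transport.simps
  proof (rule sum_walk_formula)
    show "transport \<sigma> r a \<in> L r" using \<sigma>(1) a by (rule transport_in)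
  qed (use L \<sigma> a card_walks[OF L \<sigma>(1) a] in auto)
qed

section \<open>Comparing arbitrary covers of an odd cycle with the trivial one\<close>

text \<open>The unmatched points of \<open>A\<close> and \<open>B\<close> are equinumerous and can
  be paired arbitrarily. Completing the matchings of a cover only adds forbidden pairs, so a lower
  bound on colourings may assume bijections.\<close>

lemma partial_matching_extends_to_bij_betw:
  assumes "finite A" "finite B" "card A = card B"
    and fn: "\<And>x y z. \<lbrakk>x \<in> A; y \<in> B; z \<in> B; R x y; R x z\<rbrakk> \<Longrightarrow> y = z"
    and inj: "\<And>x y z. \<lbrakk>x \<in> A; y \<in> A; z \<in> B; R x z; R y z\<rbrakk> \<Longrightarrow> x = y"
  shows "\<exists>\<sigma>. bij_betw \<sigma> A B \<and> (\<forall>x\<in>A. \<forall>y\<in>B. R x y \<longrightarrow> \<sigma> x = y)"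
proof -
  define D where "D = {x \<in> A. \<exists>y\<in>B. R x y}"
  have "\<forall>x\<in>D. \<exists>y\<in>B. R x y" by (auto simp: D_def)
  then obtain g where g: "\<And>x. x \<in> D \<Longrightarrow> g x \<in> B \<and> R x (g x)" by metis
  have DA: "D \<subseteq> A" by (auto simp: D_def)
  have gB: "g ` D \<subseteq> B" using g by auto
  have "inj_on g D"
  proof (rule inj_onI)
    fix x y assume "x \<in> D" "y \<in> D" "g x = g y"
    then show "x = y" using g[of x] g[of y] inj[of x y "g x"] DA by auto
  qed
  then have gD: "bij_betw g D (g ` D)" by (simp add: bij_betw_def)
  have "card (A - D) = card (B - g ` D)"
    using assms(1-3) DA gB bij_betw_same_card[OF gD]
    by (simp add: card_Diff_subset finite_subset)
  then obtain h where h: "bij_betw h (A - D) (B - g ` D)"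
    using finite_same_card_bij[of "A - D" "B - g ` D"] assms(1,2) by blast
  have "bij_betw (\<lambda>x. if x \<in> D then g x else h x) (D \<union> (A - D)) (g ` D \<union> (B - g ` D))"
    by (rule bij_betw_disjoint_Un[OF gD h]) auto
  moreover have "D \<union> (A - D) = A" "g ` D \<union> (B - g ` D) = B" using DA gB by auto
  moreover have "(if x \<in> D then g x else h x) = y" if "x \<in> A" "y \<in> B" "R x y" for x y
    using that g[of x] fn[of x y "g x"] by (auto simp: D_def)
  ultimately show ?thesis by auto
qed

text \<open>Replaces successors modulo the length by a path and one closing edge, the shape of
  \<open>closed_walks\<close>.\<close>

lemma ball_arcs_cycle_graph_iff:
  "(\<forall>(u, v)\<in>parcs (cycle_graph (Suc r)). P u v) \<longleftrightarrow>
     (\<forall>i<r. P i (Suc i) \<and> P (Suc i) i) \<and> P r 0 \<and> P 0 r"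
proof -
  have "parcs (cycle_graph (Suc r))
      = (\<lambda>i. (i, Suc i)) ` {..<r} \<union> (\<lambda>i. (Suc i, i)) ` {..<r} \<union> {(r, 0), (0, r)}"
    by (auto simp: cycle_graph_def mod_Suc image_iff split: if_splits)
  then show ?thesis by auto
qed

lemma pverts_cycle_graph [simp]: "pverts (cycle_graph n) = {..<n}"
  by (simp add: cycle_graph_def)

definition cycle_colorings :: "nat \<Rightarrow> nat \<Rightarrow> (nat \<Rightarrow> nat) set" where
  "cycle_colorings n q =
     {f \<in> {..<n} \<rightarrow>\<^sub>E {..<q}. \<forall>(u, v)\<in>parcs (cycle_graph n). f u \<noteq> f v}"

lemma finite_cycle_colorings: "finite (cycle_colorings n q)"
  unfolding cycle_colorings_def by (rule finite_subset[OF Collect_restrict]) (auto intro: finite_PiE)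

text \<open>The trivial cover has trivial monodromy, so the fixed-point case of
  \<open>card_closed_walks\<close> applies, with a negative sign because the length is odd.\<close>

lemma card_cycle_colorings_at:
  assumes "a < q"
  shows "int q * int (card {f \<in> cycle_colorings (2 * m + 1) q. f 0 = a})
       = (int q - 1) ^ (2 * m + 1) - (int q - 1)"
proof -
  have "{f \<in> cycle_colorings (2 * m + 1) q. f 0 = a}
      = closed_walks (\<lambda>_. {..<q}) (\<lambda>_ c. c) (2 * m) a"
    by (auto simp: cycle_colorings_def closed_walks_def ball_arcs_cycle_graph_iff eq_commute)
  moreover have "transport (\<lambda>_ c. c) r a = a" for r by (induction r) auto
  ultimately show ?thesis
    using card_closed_walks[of "2 * m" "\<lambda>_. {..<q}" q "\<lambda>_ c. c" a] assms
    by (simp add: bij_betw_def)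
qed

lemma card_cycle_colorings:
  assumes "q \<ge> 1"
  shows "int (card (cycle_colorings (2 * m + 1) q)) = (int q - 1) ^ (2 * m + 1) - (int q - 1)"
proof -
  have "cycle_colorings (2 * m + 1) q = (\<Union>a\<in>{..<q}. {f \<in> cycle_colorings (2 * m + 1) q. f 0 = a})"
    by (auto simp: cycle_colorings_def)
  then have "card (cycle_colorings (2 * m + 1) q)
      = card (\<Union>a\<in>{..<q}. {f \<in> cycle_colorings (2 * m + 1) q. f 0 = a})" by simp
  also have "\<dots> = (\<Sum>a<q. card {f \<in> cycle_colorings (2 * m + 1) q. f 0 = a})"
    by (rule card_UN_disjoint) (auto simp: finite_cycle_colorings)
  finally have "int q * int (card (cycle_colorings (2 * m + 1) q))
      = (\<Sum>a<q. int q * int (card {f \<in> cycle_colorings (2 * m + 1) q. f 0 = a}))"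
    by (simp add: sum_distrib_left)
  also have "\<dots> = (\<Sum>a<q. (int q - 1) ^ (2 * m + 1) - (int q - 1))"
    by (intro sum.cong) (simp_all only: card_cycle_colorings_at lessThan_iff)
  finally have "int q * int (card (cycle_colorings (2 * m + 1) q))
      = int q * ((int q - 1) ^ (2 * m + 1) - (int q - 1))" by simp
  then show ?thesis using assms by simp
qed

text \<open>For odd length the monodromy term is \<open>-(q - 1)\<close> at fixed points and
  \<open>1\<close> elsewhere, so trivial monodromy is the worst case. The bound follows by summing
  over the \<open>q\<close> starting points.\<close>

lemma odd_cycle_cover_colorings_ge:
  assumes "m \<ge> 1" "q \<ge> 1" and cov: "is_fold_cover q (cycle_graph (2 * m + 1)) L H"
  shows "int (card (cover_colorings (cycle_graph (2 * m + 1)) H)) \<ge> (int q - 1) ^ (2 * m + 1) - (int q - 1)"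
proof -
  define r where "r = 2 * m"
  let ?C = "cycle_graph (Suc r)"
  have C: "pair_graph ?C" using assms(1) by (intro pair_graph_cycle_graph) (simp add: r_def)
  have c: "is_cover ?C L H" and card: "\<And>i. i \<le> r \<Longrightarrow> card (L i) = q"
    using cov by (auto simp: is_fold_cover_def r_def)
  interpret H: pair_graph H using is_cover_pair_graph[OF c] .
  have Hsym: "(u, v) \<in> parcs H \<Longrightarrow> (v, u) \<in> parcs H" for u v
    using H.pair_sym_arcs by (auto simp: symmetric_def sym_def)
  have fin: "finite (L i)" if "i \<le> r" for i
    using card[OF that] assms(2) by (intro card_ge_0_finite) simp
  have arcs: "(\<forall>i<r. (i, Suc i) \<in> parcs ?C \<and> (Suc i, i) \<in> parcs ?C) \<and> (r, 0) \<in> parcs ?C \<and> (0, r) \<in> parcs ?C"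
    using ball_arcs_cycle_graph_iff[of r "\<lambda>u v. (u, v) \<in> parcs ?C"] by auto
  have ext: "\<exists>\<sigma>. bij_betw \<sigma> (L i) (L j) \<and> (\<forall>x\<in>L i. \<forall>y\<in>L j. (x, y) \<in> parcs H \<longrightarrow> \<sigma> x = y)"
    if ij: "i \<le> r" "j \<le> r" "(i, j) \<in> parcs ?C" "(j, i) \<in> parcs ?C" for i j
  proof (rule partial_matching_extends_to_bij_betw)
    show "x = y" if "x \<in> L i" "y \<in> L i" "z \<in> L j" "(x, z) \<in> parcs H" "(y, z) \<in> parcs H" for x y z
      using is_cover_matching[OF c ij(4), of z x y] that Hsym by blast
  qed (use ij fin card is_cover_matching[OF c ij(3)] in auto)
  \<comment> \<open>One bijection per edge of the cycle; at \<open>i = r\<close> the target wraps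
    around to \<open>L 0\<close>.\<close>
  have "\<exists>\<sigma>. \<forall>i\<le>r. bij_betw (\<sigma> i) (L i) (L (if i < r then Suc i else 0)) \<and>
     (\<forall>x\<in>L i. \<forall>y\<in>L (if i < r then Suc i else 0). (x, y) \<in> parcs H \<longrightarrow> \<sigma> i x = y)"
  proof (rule choice, intro allI)
    fix i show "\<exists>s. i \<le> r \<longrightarrow> bij_betw s (L i) (L (if i < r then Suc i else 0)) \<and>
     (\<forall>x\<in>L i. \<forall>y\<in>L (if i < r then Suc i else 0). (x, y) \<in> parcs H \<longrightarrow> s x = y)"
    proof (cases "i \<le> r")
      case True
      have "\<exists>\<sigma>. bij_betw \<sigma> (L i) (L (if i < r then Suc i else 0)) \<and>
        (\<forall>x\<in>L i. \<forall>y\<in>L (if i < r then Suc i else 0). (x, y) \<in> parcs H \<longrightarrow> \<sigma> x = y)"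
        using True arcs by (intro ext) auto
      then show ?thesis by blast
    qed simp
  qed
  then obtain \<sigma> where \<sigma>: "\<And>i. i \<le> r \<Longrightarrow> bij_betw (\<sigma> i) (L i) (L (if i < r then Suc i else 0))"
    "\<And>i x y. i \<le> r \<Longrightarrow> x \<in> L i \<Longrightarrow> y \<in> L (if i < r then Suc i else 0) \<Longrightarrow> (x, y) \<in> parcs H \<Longrightarrow> \<sigma> i x = y"
    by blast
  have \<sigma>1: "bij_betw (\<sigma> i) (L i) (L (Suc i))" if "i < r" for i
    using \<sigma>(1)[of i] that by simp
  have \<sigma>2: "bij_betw (\<sigma> r) (L r) (L 0)" using \<sigma>(1)[of r] by simp
  \<comment> \<open>The bijections contain all edges of \<open>H\<close> between consecutive parts,
    so whatever avoids \<open>\<sigma>\<close> avoids \<open>H\<close>.\<close>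
  have sub: "(\<Union>a\<in>L 0. closed_walks L \<sigma> r a) \<subseteq> transversal_colorings ?C L H"
  proof clarify
    fix f a assume "f \<in> closed_walks L \<sigma> r a"
    then have f: "f \<in> Pi\<^sub>E {..<Suc r} L" "\<And>i. i < r \<Longrightarrow> f (Suc i) \<noteq> \<sigma> i (f i)" "\<sigma> r (f r) \<noteq> f 0"
      by (auto simp: closed_walks_def)
    have mem: "f i \<in> L i" if "i \<le> r" for i using PiE_mem[OF f(1), of i] that by simp
    have 1: "(f i, f (Suc i)) \<notin> parcs H" if "i < r" for i
      using \<sigma>(2)[of i "f i" "f (Suc i)"] mem that f(2)[OF that] by auto
    have 2: "(f r, f 0) \<notin> parcs H"
      using \<sigma>(2)[of r "f r" "f 0"] mem f(3) by auto
    show "f \<in> transversal_colorings ?C L H"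
      using f(1) 1 2 Hsym unfolding transversal_colorings_def ball_arcs_cycle_graph_iff by auto
  qed
  have "finite (Pi\<^sub>E {..<Suc r} L)" using fin by (intro finite_PiE) auto
  then have finT: "finite (transversal_colorings ?C L H)"
    by (simp add: transversal_colorings_def)
  have "int q * ((int q - 1) ^ Suc r - (int q - 1)) = (\<Sum>a\<in>L 0. (int q - 1) ^ Suc r - (int q - 1))"
    using card[of 0] by simp
  also have "\<dots> \<le> (\<Sum>a\<in>L 0. int q * int (card (closed_walks L \<sigma> r a)))"
  proof (rule sum_mono)
    fix a assume "a \<in> L 0"
    from card_closed_walks[OF fin card \<sigma>1 \<sigma>2 this]
    show "(int q - 1) ^ Suc r - (int q - 1) \<le> int q * int (card (closed_walks L \<sigma> r a))"
      using assms(2) by (simp add: r_def del: transport.simps)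
  qed
  also have "\<dots> = int q * int (\<Sum>a\<in>L 0. card (closed_walks L \<sigma> r a))"
    by (simp add: sum_distrib_left)
  also have "(\<Sum>a\<in>L 0. card (closed_walks L \<sigma> r a)) = card (\<Union>a\<in>L 0. closed_walks L \<sigma> r a)"
  proof (rule card_UN_disjoint[symmetric])
    show "\<forall>a\<in>L 0. finite (closed_walks L \<sigma> r a)"
      using finite_subset[OF sub finT] fin[of 0] by auto
  qed (use fin[of 0] in \<open>auto simp: closed_walks_def\<close>)
  also have "int q * int (card (\<Union>a\<in>L 0. closed_walks L \<sigma> r a)) \<le> int q * int (card (transversal_colorings ?C L H))"
    using card_mono[OF finT sub] by (intro mult_left_mono) auto
  finally have "(int q - 1) ^ Suc r - (int q - 1) \<le> int (card (transversal_colorings ?C L H))"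
    using assms(2) by simp
  then show ?thesis using card_cover_colorings[OF C c] by (simp add: r_def)
qed

text \<open>The trivial cover attains the lower bound.\<close>

lemma dp_color_function_odd_cycle:
  assumes "m \<ge> 1" "q \<ge> 1"
  shows "int (dp_color_function (cycle_graph (2 * m + 1)) q) = (int q - 1) ^ (2 * m + 1) - (int q - 1)"
proof -
  let ?C = "cycle_graph (2 * m + 1)" and ?M = "\<lambda>_ _ c d. c = d"
  let ?H = "relation_cover ?C q ?M"
  have C: "pair_graph ?C" using assms(1) by (intro pair_graph_cycle_graph) simp
  have cov: "is_fold_cover q ?C (\<lambda>v. {v} \<times> {..<q}) ?H"
    by (rule is_fold_cover_relation_cover[OF C]) auto
  then have c: "is_cover ?C (\<lambda>v. {v} \<times> {..<q}) ?H" by (simp add: is_fold_cover_def)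
  have "card (cover_colorings ?C ?H) = card (cycle_colorings (2 * m + 1) q)"
    using bij_betw_same_card[OF transversal_colorings_relation_cover[OF C, of q ?M]]
      card_cover_colorings[OF C c]
    by (simp only: cycle_colorings_def pverts_cycle_graph)
  \<comment> \<open>\<open>dp_color_function\<close> ranges over covers on natural numbers, so the
    extremal cover is relabelled.\<close>
  moreover obtain L' :: "nat \<Rightarrow> nat set" and H' \<phi> where L': "is_fold_cover q ?C L' H'"
    "bij_betw \<phi> (cover_colorings ?C ?H) (cover_colorings ?C H')"
    using fold_cover_nat[OF C cov] by blast
  ultimately have card: "card (cycle_colorings (2 * m + 1) q) = card (cover_colorings ?C H')"
    using bij_betw_same_card[OF L'(2)] by simp
  have "dp_color_function ?C q = card (cycle_colorings (2 * m + 1) q)"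
    unfolding dp_color_function_def
  proof (rule Least_equality)
    show "\<exists>(L :: nat \<Rightarrow> nat set) H. is_fold_cover q ?C L H \<and>
        card (cycle_colorings (2 * m + 1) q) = card (cover_colorings ?C H)"
      using L'(1) card by blast
  next
    fix n assume "\<exists>(L :: nat \<Rightarrow> nat set) H. is_fold_cover q ?C L H \<and> n = card (cover_colorings ?C H)"
    then obtain L :: "nat \<Rightarrow> nat set" and H where "is_fold_cover q ?C L H" "n = card (cover_colorings ?C H)"
      by blast
    then show "card (cycle_colorings (2 * m + 1) q) \<le> n"
      using odd_cycle_cover_colorings_ge[OF assms, of L H] card_cycle_colorings[OF assms(2), of m] by simp
  qed
  then show ?thesis using card_cycle_colorings[OF assms(2), of m] by simp
qed

subsection \<open>Covering all shift vectors by few shifts\<close>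

text \<open>Adding \<open>s\<close> coordinatewise modulo \<open>q\<close> permutes the vectors, so
  the count is that of injective vectors. Its independence of \<open>s\<close> is what double
  counting in \<open>greedy_cover_step\<close> uses.\<close>

lemma card_inj_shifts:
  fixes s :: "nat \<Rightarrow> nat"
  assumes s: "s \<in> {..<k} \<rightarrow>\<^sub>E {..<q}"
  shows "card {a \<in> {..<k} \<rightarrow>\<^sub>E {..<q}. inj_on (\<lambda>i. (s i + a i) mod q) {..<k}}
       = (\<Prod>i<k. q - i)"
proof -
  define \<phi> where "\<phi> a = (\<lambda>i\<in>{..<k}. (s i + a i) mod q)" for a :: "nat \<Rightarrow> nat"
  \<comment> \<open>The inverse translation; adding \<open>q - s i\<close> avoids negative
    values.\<close>
  define \<psi> where "\<psi> a = (\<lambda>i\<in>{..<k}. (a i + (q - s i)) mod q)" for a :: "nat \<Rightarrow> nat"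
  have sq: "s i < q" if "i < k" for i using s that by auto
  have "bij_betw \<phi> {a \<in> {..<k} \<rightarrow>\<^sub>E {..<q}. inj_on (\<lambda>i. (s i + a i) mod q) {..<k}}
          {a \<in> {..<k} \<rightarrow>\<^sub>E {..<q}. inj_on a {..<k}}" (is "bij_betw _ ?A ?B")
  proof (rule bij_betw_byWitness[where f' = \<psi>])
    have 1: "((s i + x) mod q + (q - s i)) mod q = x" if "i < k" "x < q" for i x
    proof -
      have "((s i + x) mod q + (q - s i)) mod q = (s i + x + (q - s i)) mod q"
        by (simp add: mod_add_left_eq)
      also have "s i + x + (q - s i) = x + q" using sq[OF that(1)] by simp
      finally show ?thesis using that by simp
    qed
    have 2: "(s i + (x + (q - s i)) mod q) mod q = x" if "i < k" "x < q" for i x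
    proof -
      have "(s i + (x + (q - s i)) mod q) mod q = (s i + (x + (q - s i))) mod q"
        by (simp add: mod_add_right_eq)
      also have "s i + (x + (q - s i)) = x + q" using sq[OF that(1)] by simp
      finally show ?thesis using that by simp
    qed
    show "\<forall>a\<in>?A. \<psi> (\<phi> a) = a"
      using 1 by (auto simp: \<phi>_def \<psi>_def fun_eq_iff PiE_iff extensional_def)
    show 3: "\<forall>a\<in>?B. \<phi> (\<psi> a) = a"
      using 2 by (auto simp: \<phi>_def \<psi>_def fun_eq_iff PiE_iff extensional_def)
    have q: "0 < q" if "i < k" for i using sq[OF that] by simp
    show "\<phi> ` ?A \<subseteq> ?B"
      using q by (auto simp: \<phi>_def inj_on_def)
    show "\<psi> ` ?B \<subseteq> ?A"
    proof clarify
      fix a assume a: "a \<in> {..<k} \<rightarrow>\<^sub>E {..<q}" "inj_on a {..<k}"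
      have "(s i + \<psi> a i) mod q = a i" if "i < k" for i
        using 2[OF that, of "a i"] a that by (auto simp: \<psi>_def)
      then have "inj_on (\<lambda>i. (s i + \<psi> a i) mod q) {..<k}"
        using a(2) by (simp add: inj_on_def)
      then show "\<psi> a \<in> {..<k} \<rightarrow>\<^sub>E {..<q} \<and> inj_on (\<lambda>i. (s i + \<psi> a i) mod q) {..<k}"
        using q by (auto simp: \<psi>_def)
    qed
  qed
  then have "card ?A = card ?B" by (rule bij_betw_same_card)
  also have "\<dots> = (\<Prod>i<k. q - i)"
    using card_inj_on_subset_funcset[of "{..<k}" "{..<q}" "{..<k}"]
    by (simp add: lessThan_atLeast0)
  finally show ?thesis .
qed

text \<open>
  The bound is strict from the second step on, because an element already chosen covers nothing
  that is still uncovered. Strictness matters: for \<open>k = 2\<close> the quotient in \<open>dp_const\<close> is an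
  integer, and averaging alone would leave one uncovered point.
\<close>

lemma greedy_cover_step:
  fixes R :: "'a \<Rightarrow> 'b \<Rightarrow> bool"
  assumes fin: "finite X" "finite Y" and "X \<noteq> {}"
    and R: "\<And>y. y \<in> Y \<Longrightarrow> card {x \<in> X. R x y} = d"
    and A: "A \<subseteq> X" and "d > 0"
  defines "U \<equiv> \<lambda>A. {y \<in> Y. \<forall>x\<in>A. \<not> R x y}"
  shows "\<exists>x\<in>X. card X * card (U (insert x A)) \<le> (card X - d) * card (U A) \<and>
    (A \<noteq> {} \<longrightarrow> U A \<noteq> {} \<longrightarrow> card X * card (U (insert x A)) < (card X - d) * card (U A))"
proof -
  \<comment> \<open>\<open>g x\<close> is the number of points newly covered by \<open>x\<close>.
    Double counting gives its average over \<open>X\<close>, and the chosen \<open>x\<close>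
    maximises it.\<close>
  define g where "g x = card {y \<in> U A. R x y}" for x
  have finU: "finite (U A)" using fin by (simp add: U_def)
  have total: "(\<Sum>x\<in>X. g x) = d * card (U A)"
  proof -
    have "(\<Sum>x\<in>X. g x) = (\<Sum>y\<in>U A. card {x \<in> X. R x y})"
      unfolding g_def by (rule sum_multicount_gen) (use fin finU in auto)
    also have "\<dots> = (\<Sum>y\<in>U A. d)" by (rule sum.cong) (auto simp: U_def R)
    finally show ?thesis by simp
  qed
  have "Max (g ` X) \<in> g ` X" using fin(1) \<open>X \<noteq> {}\<close> by (intro Max_in) auto
  then obtain x where "x \<in> X" "Max (g ` X) = g x" by blast
  then have x: "x \<in> X" "\<And>y. y \<in> X \<Longrightarrow> g y \<le> g x"
    using Max_ge[of "g ` X"] fin(1) by auto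
  have split: "card (U (insert x A)) + g x = card (U A)"
  proof -
    have "U A = U (insert x A) \<union> {y \<in> U A. R x y}" "U (insert x A) \<inter> {y \<in> U A. R x y} = {}"
      by (auto simp: U_def)
    moreover have "finite (U (insert x A))" "finite {y \<in> U A. R x y}"
      using fin by (auto simp: U_def)
    ultimately show ?thesis unfolding g_def by (metis card_Un_disjoint)
  qed
  have le: "d * card (U A) \<le> card X * g x"
    using sum_bounded_above[of X g "g x"] x total by simp
  have lt: "d * card (U A) < card X * g x" if "A \<noteq> {}" "U A \<noteq> {}"
  proof -
    from A \<open>A \<noteq> {}\<close> obtain a where a: "a \<in> A" "a \<in> X" by blast
    have "{y \<in> U A. R a y} = {}" using a by (auto simp: U_def)
    then have ga: "g a = 0" unfolding g_def by (simp only: card.empty)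
    have "0 < d * card (U A)" using that finU \<open>d > 0\<close> by (simp add: card_gt_0_iff)
    then have "0 < card X * g x" using le by linarith
    then have "g a < g x" using ga by simp
    then have "(\<Sum>x\<in>X. g x) < (\<Sum>y\<in>X. g x)"
      using a x by (intro sum_strict_mono_ex1 fin) auto
    then show ?thesis using total by simp
  qed
  have eq: "int (card X) * int (card (U (insert x A))) = int (card X) * int (card (U A)) - int (card X) * int (g x)"
    unfolding split[symmetric] by (simp add: distrib_left)
  \<comment> \<open>Ensures that the difference \<open>card X - d\<close> is not truncated.\<close>
  have dX: "d \<le> card X" if "U A \<noteq> {}"
  proof -
    from \<open>U A \<noteq> {}\<close> obtain y where "y \<in> Y" by (auto simp: U_def)
    then have "card {x \<in> X. R x y} = d" by (rule R)
    then show ?thesis using card_mono[of X "{x \<in> X. R x y}"] fin by auto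
  qed
  show ?thesis
  proof (cases "U A = {}")
    case True
    then have "card (U (insert x A)) = 0" using split by simp
    then show ?thesis using x(1) True by (intro bexI[of _ x]) auto
  next
    case False
    have r: "int ((card X - d) * card (U A)) = int (card X) * int (card (U A)) - int d * int (card (U A))"
      using dX[OF False] by (simp add: of_nat_diff algebra_simps)
    have "int (card X * card (U (insert x A))) \<le> int ((card X - d) * card (U A))"
      unfolding r using eq le by (simp flip: of_nat_mult)
    moreover have "int (card X * card (U (insert x A))) < int ((card X - d) * card (U A))" if "A \<noteq> {}"
      unfolding r using eq lt[OF that False] by (simp flip: of_nat_mult)
    ultimately show ?thesis using x(1) by (intro bexI[of _ x]) (auto simp only: of_nat_le_iff of_nat_less_iff)
  qed
qed

text \<open>Each step leaves at most the fraction \<open>1 - d / card X\<close> of the points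
  uncovered. A nonempty remainder after \<open>n\<close> steps would have fewer than one point;
  \<open>n \<ge> 2\<close> secures the strict inequality.\<close>

lemma greedy_cover:
  fixes R :: "'a \<Rightarrow> 'b \<Rightarrow> bool"
  assumes fin: "finite X" "finite Y" and "X \<noteq> {}"
    and R: "\<And>y. y \<in> Y \<Longrightarrow> card {x \<in> X. R x y} = d" and "d > 0" "d < card X"
    and n: "n \<ge> 2" "real (card Y) * (1 - real d / real (card X)) ^ n \<le> 1"
  shows "\<exists>A\<subseteq>X. card A \<le> n \<and> (\<forall>y\<in>Y. \<exists>x\<in>A. R x y)"
proof -
  define U where "U A = {y \<in> Y. \<forall>x\<in>A. \<not> R x y}" for A
  define \<beta> where "\<beta> = 1 - real d / real (card X)"
  have X: "0 < real (card X)" using fin \<open>X \<noteq> {}\<close> by (simp add: card_gt_0_iff)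
  have \<beta>: "0 < \<beta>" using \<open>d < card X\<close> X by (simp add: \<beta>_def field_simps)
  have \<beta>X: "real (card X - d) = real (card X) * \<beta>"
    using \<open>d < card X\<close> X by (simp add: \<beta>_def of_nat_diff field_simps)
  have step: "\<exists>x\<in>X. real (card (U (insert x A))) \<le> \<beta> * card (U A) \<and>
    (A \<noteq> {} \<longrightarrow> U A \<noteq> {} \<longrightarrow> real (card (U (insert x A))) < \<beta> * card (U A))" if A: "A \<subseteq> X" for A
  proof -
    obtain x where x: "x \<in> X" "card X * card (U (insert x A)) \<le> (card X - d) * card (U A)"
      "A \<noteq> {} \<longrightarrow> U A \<noteq> {} \<longrightarrow> card X * card (U (insert x A)) < (card X - d) * card (U A)"
      using greedy_cover_step[where X = X and Y = Y and R = R and d = d and A = A] assms A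
      unfolding U_def by blast
    have "real (card X) * card (U (insert x A)) \<le> real (card X - d) * card (U A)"
      using x(2) by (simp only: of_nat_le_iff flip: of_nat_mult)
    then have "real (card (U (insert x A))) \<le> \<beta> * card (U A)"
      unfolding \<beta>X using X by (simp add: mult.assoc)
    moreover have "real (card (U (insert x A))) < \<beta> * card (U A)" if "A \<noteq> {}" "U A \<noteq> {}"
    proof -
      have "real (card X) * card (U (insert x A)) < real (card X - d) * card (U A)"
        using x(3)[rule_format, OF that] by (simp only: of_nat_less_iff flip: of_nat_mult)
      then show ?thesis unfolding \<beta>X using X by (simp add: mult.assoc)
    qed
    ultimately show ?thesis using x(1) by blast
  qed
  \<comment> \<open>The case \<open>j = 0\<close> already has one element chosen, because the strict
    form of \<open>step\<close> needs \<open>A\<close> nonempty; strictness is claimed only for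
    \<open>j > 0\<close>.\<close>
  have "\<exists>A\<subseteq>X. A \<noteq> {} \<and> card A \<le> Suc j \<and> real (card (U A)) \<le> card Y * \<beta> ^ Suc j \<and>
      (j > 0 \<longrightarrow> U A \<noteq> {} \<longrightarrow> real (card (U A)) < card Y * \<beta> ^ Suc j)" for j
  proof (induction j)
    case 0
    obtain x where "x \<in> X" "real (card (U {x})) \<le> \<beta> * card (U {})"
      using step[of "{}"] by auto
    then show ?case by (intro exI[of _ "{x}"]) (simp add: U_def mult.commute)
  next
    case (Suc j)
    then obtain A where A: "A \<subseteq> X" "A \<noteq> {}" "card A \<le> Suc j" "real (card (U A)) \<le> card Y * \<beta> ^ Suc j"
      by blast
    obtain x where x: "x \<in> X" "real (card (U (insert x A))) \<le> \<beta> * card (U A)"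
      "U A \<noteq> {} \<longrightarrow> real (card (U (insert x A))) < \<beta> * card (U A)"
      using step[OF A(1)] A(2) by blast
    have b: "\<beta> * card (U A) \<le> card Y * \<beta> ^ Suc (Suc j)"
      using mult_left_mono[OF A(4), of \<beta>] \<beta> by (simp add: algebra_simps)
    \<comment> \<open>A nonempty remainder now means that the strict bound was available in this
      step.\<close>
    have "U (insert x A) \<noteq> {} \<Longrightarrow> U A \<noteq> {}" by (auto simp: U_def)
    moreover have "card (insert x A) \<le> Suc (Suc j)"
      using card_insert_le_m1[of "Suc (Suc j)" A x] A(3) by simp
    ultimately show ?case
      using A x b by (intro exI[of _ "insert x A"]) auto
  qed
  from this[of "n - 1"] n(1) obtain A where A: "A \<subseteq> X" "card A \<le> n"
    "U A \<noteq> {} \<longrightarrow> real (card (U A)) < card Y * \<beta> ^ n"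
    by auto
  have "U A = {}"
  proof (rule ccontr)
    assume ne: "U A \<noteq> {}"
    then have "real (card (U A)) < 1" using A(3) n(2) by (simp add: \<beta>_def)
    moreover have "finite (U A)" using fin by (simp add: U_def)
    ultimately show False using ne by simp
  qed
  then show ?thesis using A by (intro exI[of _ A]) (auto simp: U_def)
qed

section \<open>The number of greedy steps\<close>

text \<open>The factors run from \<open>k + 2\<close> down to \<open>3\<close>.\<close>

lemma prod_descending_eq: "2 * (\<Prod>i<k. k + 2 - i) = fact (k + 2)"
proof (induction k)
  case (Suc k)
  have "(\<Prod>i<Suc k. Suc k + 2 - i) = (k + 3) * (\<Prod>i<k. k + 2 - i)"
    by (subst prod.lessThan_Suc_shift) (simp add: algebra_simps)
  then show ?case using Suc by (simp add: algebra_simps)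
qed simp

text \<open>Makes the argument of the subtracted logarithm in \<open>dp_const\<close> a positive
  integer.\<close>

lemma fact_less_twice_power:
  assumes "k \<ge> 2"
  shows "fact (k + 1) < 2 * (k + 2) ^ (k - 1)"
proof -
  have "fact (j + 3) < 2 * (j + 4) ^ (j + 1)" for j :: nat
  proof (induction j)
    case 0 then show ?case by (simp add: fact_numeral)
  next
    case (Suc j)
    have "fact (Suc j + 3) = (j + 4) * fact (j + 3)"
      by (simp add: numeral_eq_Suc)
    also have "\<dots> < (j + 4) * (2 * (j + 4) ^ (j + 1))" using Suc by simp
    also have "\<dots> = 2 * (j + 4) ^ (j + 2)" by simp
    also have "\<dots> \<le> 2 * (Suc j + 4) ^ (j + 2)" by (intro mult_left_mono power_mono) auto
    finally show ?case by simp
  qed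
  from this[of "k - 2"] assms show ?thesis by (simp add: numeral_eq_Suc Suc_diff_Suc)
qed

text \<open>\<open>\<beta>\<close> is the proportion of shift vectors that fail for a fixed
  \<open>s\<close>. The denominator in \<open>dp_const\<close> equals \<open>- ln \<beta>\<close>,
  so the ceiling is an exponent just large enough for the second claim.\<close>

lemma dp_const_properties:
  assumes "k \<ge> 2"
  defines "\<beta> \<equiv> 1 - real (\<Prod>i<k. k + 2 - i) / (real k + 2) ^ k"
  shows "dp_const k \<ge> 2" and "(real k + 2) ^ k * \<beta> ^ nat (dp_const k) \<le> 1"
    and "0 < \<beta>" 
proof -
  define Q where "Q = (real k + 2) ^ (k - 1)"
  define X where "X = 2 * Q - fact (k + 1)"
  have Q: "0 < Q" by (simp add: Q_def)
  have Qk: "(real k + 2) ^ k = (real k + 2) * Q"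
    using assms(1) by (simp add: Q_def flip: power_Suc)
  have "real (fact (k + 1)) + 1 \<le> real (2 * (k + 2) ^ (k - 1))"
    using fact_less_twice_power[OF assms(1)] by (metis Suc_eq_plus1 Suc_leI of_nat_1 of_nat_add of_nat_le_iff)
  then have X1: "1 \<le> X" by (simp add: X_def Q_def add.commute del: fact_Suc)
  have "2 * real (\<Prod>i<k. k + 2 - i) = fact (k + 2)"
    using arg_cong[OF prod_descending_eq[of k], of real]
    by (simp only: of_nat_mult of_nat_fact of_nat_numeral)
  also have "\<dots> = (real k + 2) * fact (k + 1)"
    using fact_Suc[of "k + 1", where ?'a = real] by (simp add: add.commute del: fact_Suc)
  finally have prod: "real (\<Prod>i<k. k + 2 - i) = (real k + 2) * fact (k + 1) / 2" by simp
  have \<beta>: "\<beta> = X / (2 * Q)"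
  proof -
    have "(real k + 2) * F / 2 / ((real k + 2) * Q) = F / (2 * Q)" for F
      using Q by (simp add: divide_simps)
    then show ?thesis
      unfolding \<beta>_def prod Qk X_def using Q by (simp add: diff_divide_distrib del: fact_Suc)
  qed
  show \<beta>0: "0 < \<beta>" using \<beta> X1 Q by simp
  have "fact (k + 1) > (0 :: real)" by simp
  then have \<beta>1: "\<beta> < 1" using Q by (simp add: \<beta> X_def del: fact_Suc)
  have ln: "ln 2 + (real k - 1) * ln (real k + 2) - ln X = - ln \<beta>"
  proof -
    have "ln \<beta> = ln X - (ln 2 + ln Q)" using X1 Q by (simp add: \<beta> ln_div ln_mult)
    moreover have "ln Q = (real k - 1) * ln (real k + 2)"
      using assms(1) by (simp add: Q_def ln_realpow of_nat_diff)
    ultimately show ?thesis by simp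
  qed
  have pos: "- ln \<beta> > 0" using \<beta>0 \<beta>1 by simp
  define c where "c = dp_const k"
  have "c = \<lceil>real k * ln (real k + 2) / (- ln \<beta>)\<rceil>"
    using assms(1) unfolding c_def dp_const_def ln[symmetric] X_def Q_def by (simp del: fact_Suc)
  then have c: "real k * ln (real k + 2) / (- ln \<beta>) \<le> c" by simp
  have "0 < real k * ln (real k + 2) / (- ln \<beta>)"
    using assms(1) pos by (intro divide_pos_pos mult_pos_pos) auto
  then have c0: "0 < c" using c by linarith
  have "real k * ln (real k + 2) \<le> real (nat c) * (- ln \<beta>)"
    using c c0 pos by (simp only: pos_divide_le_eq) simp
  then have "ln ((real k + 2) ^ k * \<beta> ^ nat c) \<le> 0"
    using \<beta>0 by (simp add: ln_mult ln_realpow)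
  then show le: "(real k + 2) ^ k * \<beta> ^ nat (dp_const k) \<le> 1"
    using \<beta>0 by (simp add: c_def)
  \<comment> \<open>Exponent 1 does not suffice: it gives \<open>(real k + 2) * X / 2\<close>, which
    is at least 2. \<open>greedy_cover\<close> needs two steps for strictness.\<close>
  show "dp_const k \<ge> 2"
  proof (rule ccontr)
    assume "\<not> dp_const k \<ge> 2"
    then have "dp_const k = 1" using c0 by (simp add: c_def)
    then have "(real k + 2) * Q * \<beta> \<le> 1" using le by (simp add: Qk)
    also have "(real k + 2) * Q * \<beta> = (real k + 2) * X / 2" using Q by (simp add: \<beta>)
    finally have "(real k + 2) * X \<le> 2" by simp
    moreover have "(real k + 2) * 1 \<le> (real k + 2) * X" using X1 by (intro mult_left_mono) auto
    ultimately have "(real k + 2) * 1 \<le> 2" by (rule order.trans[rotated])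
    then show False using assms(1) by simp
  qed
qed

text \<open>\<open>greedy_cover\<close> with the vectors \<open>s\<close> as points to be covered
  and the shift vectors \<open>a\<close> covering them.\<close>

lemma exists_shifts_covering:
  assumes "k \<ge> 1"
  shows "\<exists>A \<subseteq> {..<k} \<rightarrow>\<^sub>E {..<k + 2}. int (card A) \<le> dp_const k \<and>
    (\<forall>s \<in> {..<k} \<rightarrow>\<^sub>E {..<k + 2}. \<exists>a\<in>A. inj_on (\<lambda>i. (s i + a i) mod (k + 2)) {..<k})"
proof (cases "k = 1")
  case True
  \<comment> \<open>With a single index injectivity is automatic, so the zero vector alone
    suffices.\<close>
  then show ?thesis
    by (intro exI[of _ "{\<lambda>i\<in>{..<k}. 0}"]) (auto simp: dp_const_def inj_on_def)
next
  case False
  then have k: "k \<ge> 2" using assms by simp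
  let ?X = "{..<k} \<rightarrow>\<^sub>E {..<k + 2}" and ?d = "\<Prod>i<k. k + 2 - i"
  have card: "real (card ?X) = (real k + 2) ^ k" "card ?X = (k + 2) ^ k"
    by (simp_all add: card_funcsetE add.commute)
  note dp = dp_const_properties[OF k]
  have d: "?d < card ?X"
  proof -
    have "real ?d < real (card ?X)" unfolding card using dp(3) by (simp add: divide_less_eq add.commute del: of_nat_prod)
    then show ?thesis by (simp only: of_nat_less_iff)
  qed
  have "\<exists>A\<subseteq>?X. card A \<le> nat (dp_const k) \<and>
      (\<forall>s\<in>?X. \<exists>a\<in>A. inj_on (\<lambda>i. (s i + a i) mod (k + 2)) {..<k})"
  proof (rule greedy_cover)
    show "?X \<noteq> {}" using card(2) by force
    show "0 < ?d" by (intro prod_pos) auto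
    show "2 \<le> nat (dp_const k)" using dp(1) by simp
    show "real (card ?X) * (1 - real ?d / real (card ?X)) ^ nat (dp_const k) \<le> 1"
      unfolding card(1) by (rule dp(2))
    show "finite ?X" "finite ?X" by (auto intro: finite_PiE)
  qed (use d card_inj_shifts in auto)
  then obtain A where "A \<subseteq> ?X" "card A \<le> nat (dp_const k)"
    "\<forall>s\<in>?X. \<exists>a\<in>A. inj_on (\<lambda>i. (s i + a i) mod (k + 2)) {..<k}"
    by blast
  then show ?thesis using dp(1) by (intro exI[of _ A]) simp
qed

subsection \<open>Covers of \<open>C\<^sub>n \<box> K\<^sub>k\<^sub>,\<^sub>t\<close>\<close>

text \<open>All even positions carry the colour of vertex \<open>0\<close>, including
  \<open>2 * m\<close>, which is adjacent to \<open>0\<close>.\<close>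

lemma odd_cycle_not_2_colorable:
  assumes proper: "\<forall>(u, v)\<in>parcs (cycle_graph (2 * m + 1)). g u \<noteq> g v"
    and S: "\<And>u. u < 2 * m + 1 \<Longrightarrow> g u \<in> S" "card S = 2"
  shows False
proof -
  have step: "\<And>i. i < 2 * m \<Longrightarrow> g i \<noteq> g (Suc i)" and last: "g (2 * m) \<noteq> g 0"
    using proper ball_arcs_cycle_graph_iff[of "2 * m" "\<lambda>u v. g u \<noteq> g v"] by simp_all
  obtain x y where xy: "S = {x, y}" using S(2) by (meson card_2_iff)
  have "g (2 * i) = g 0" if "i \<le> m" for i
    using that
  proof (induction i)
    case (Suc i)
    have "g (2 * i) \<noteq> g (Suc (2 * i))" "g (Suc (2 * i)) \<noteq> g (Suc (Suc (2 * i)))"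
      using Suc.prems step[of "2 * i"] step[of "Suc (2 * i)"] by auto
    moreover have "g (2 * i) \<in> S" "g (Suc (2 * i)) \<in> S" "g (Suc (Suc (2 * i))) \<in> S"
      using Suc.prems by (auto intro: S(1))
    ultimately have "g (Suc (Suc (2 * i))) = g (2 * i)" unfolding xy by auto
    then show ?case using Suc by simp
  qed simp
  then show False using last by blast
qed

lemma mod_add_right_cancel_less:
  fixes d e q x :: nat
  assumes "(d + x) mod q = (e + x) mod q" "d < q" "e < q"
  shows "d = e"
proof -
  obtain a b where "d + x + q * a = e + x + q * b"
    using assms(1) unfolding nat_mod_eq_iff by blast
  then have "d + q * a = e + q * b" by simp
  then have "d mod q = e mod q" unfolding nat_mod_eq_iff by blast
  then show ?thesis using assms(2,3) by simp
qed

text \<open>Splits a proper colouring into its shift \<open>f 0\<close> and a representative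
  vanishing at \<open>0\<close>. Listing only representatives saves a factor \<open>q\<close> per
  copy of the cycle.\<close>

lemma normalized_coloring_in_cycle_colorings:
  fixes f :: "nat \<Rightarrow> nat"
  assumes f: "\<And>u. u < n \<Longrightarrow> f u < q" and "n > 0"
    and proper: "\<forall>(u, v)\<in>parcs (cycle_graph n). f u \<noteq> f v"
  shows "(\<lambda>u\<in>{..<n}. (f u + (q - f 0)) mod q) \<in> {g \<in> cycle_colorings n q. g 0 = 0}"
proof -
  have q: "q > 0" "f 0 < q" using f[of 0] \<open>n > 0\<close> by auto
  have "(f u + (q - f 0)) mod q \<noteq> (f v + (q - f 0)) mod q" if uv: "(u, v) \<in> parcs (cycle_graph n)" for u v
  proof -
    have "u < n" "v < n" using uv by (auto simp: cycle_graph_def)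
    then show ?thesis using mod_add_right_cancel_less[of "f u" "q - f 0" q "f v"] f proper uv by fastforce
  qed
  moreover have "u \<in> {..<n} \<and> v \<in> {..<n}" if "(u, v) \<in> parcs (cycle_graph n)" for u v
    using that by (auto simp: cycle_graph_def)
  ultimately have "\<forall>(u, v)\<in>parcs (cycle_graph n). (\<lambda>u\<in>{..<n}. (f u + (q - f 0)) mod q) u
      \<noteq> (\<lambda>u\<in>{..<n}. (f u + (q - f 0)) mod q) v"
    by (auto simp: restrict_def)
  then show ?thesis
    using q \<open>n > 0\<close> unfolding cycle_colorings_def by simp
qed

lemma uncolorable_fold_cover_cycle_bipartite:
  fixes k m t :: nat
  defines "G \<equiv> cycle_graph (2 * m + 1) \<box> complete_bipartite_graph k t"
  assumes "k \<ge> 1" "m \<ge> 1"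
    and t: "real_of_int (dp_const k) * real (card {f \<in> cycle_colorings (2 * m + 1) (k + 2). f 0 = 0}) ^ k \<le> real t"
  shows "\<exists>(L :: nat \<times> (nat + nat) \<Rightarrow> ((nat \<times> (nat + nat)) \<times> nat) set) H.
    is_fold_cover (k + 2) G L H \<and> cover_colorings G H = {}"
proof -
  define q n where "q = k + 2" and "n = 2 * m + 1"
  define Reps where "Reps = {f \<in> cycle_colorings n q. f 0 = 0}"
  define R where "R = ({..<k} \<rightarrow>\<^sub>E Reps)"
  have G: "pair_graph G"
    unfolding G_def using \<open>m \<ge> 1\<close>
    by (intro pair_graph_cartesian_product pair_graph_cycle_graph pair_graph_complete_bipartite_graph) simp
  obtain A where A: "A \<subseteq> {..<k} \<rightarrow>\<^sub>E {..<q}" "int (card A) \<le> dp_const k"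
    "\<And>s. s \<in> {..<k} \<rightarrow>\<^sub>E {..<q} \<Longrightarrow> \<exists>a\<in>A. inj_on (\<lambda>i. (s i + a i) mod q) {..<k}"
    using exists_shifts_covering[OF \<open>k \<ge> 1\<close>] unfolding q_def by blast
  have "finite Reps" by (simp add: Reps_def finite_cycle_colorings)
  then have finR: "finite R" and cardR: "card R = card Reps ^ k"
    by (auto simp: R_def card_funcsetE intro: finite_PiE)
  have finA: "finite A" using A(1) by (rule finite_subset) (auto intro: finite_PiE)
  have "real (card (R \<times> A)) = real (card A) * real (card Reps) ^ k"
    by (simp add: card_cartesian_product cardR)
  also have "\<dots> \<le> real_of_int (dp_const k) * real (card Reps) ^ k"
    using A(2) by (intro mult_right_mono) (linarith, simp)
  also have "\<dots> \<le> real t" using t by (simp add: Reps_def n_def q_def)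
  finally have card_le: "card (R \<times> A) \<le> t" by (simp only: of_nat_le_iff)
  \<comment> \<open>The first \<open>card (R \<times> A)\<close> vertices of the t-side list all
    pairs. For later \<open>j\<close> the value \<open>h j\<close> is arbitrary, which is harmless:
    any constants modulo \<open>q\<close> still give a matching.\<close>
  obtain h where h_bij: "bij_betw h {0..<card (R \<times> A)} (R \<times> A)"
    using ex_bij_betw_nat_finite[of "R \<times> A"] finR finA by blast
  have h: "\<exists>j<t. h j = z" if "z \<in> R \<times> A" for z
  proof -
    have "z \<in> h ` {0..<card (R \<times> A)}" using h_bij that by (simp only: bij_betw_def)
    then obtain j where "j < card (R \<times> A)" "h j = z" by (auto simp only: image_iff atLeastLessThan_iff)
    then show ?thesis using card_le by (intro exI[of _ j]) simp
  qed
  define \<rho> \<alpha> where "\<rho> j = fst (h j)" and "\<alpha> j = snd (h j)" for j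
  \<comment> \<open>If colour \<open>c\<close> at \<open>(u, Inl i)\<close> is the representative's
    value at \<open>u\<close> plus a shift, the equation forbids at \<open>(u, Inr j)\<close> that
    shift plus \<open>\<alpha> j i\<close>, independently of \<open>u\<close>. Inside a copy of the
    cycle the clash is equality.\<close>
  define M :: "nat \<times> (nat + nat) \<Rightarrow> nat \<times> (nat + nat) \<Rightarrow> nat \<Rightarrow> nat \<Rightarrow> bool" where
    "M p p' c d = (case (snd p, snd p') of
        (Inl i, Inr j) \<Rightarrow> (d + \<rho> j i (fst p)) mod q = (c + \<alpha> j i) mod q
      | (Inr j, Inl i) \<Rightarrow> (c + \<rho> j i (fst p)) mod q = (d + \<alpha> j i) mod q
      | _ \<Rightarrow> c = d)" for p p' c d
  let ?H = "relation_cover G q M" and ?L = "\<lambda>v. {v} \<times> {..<q}"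
  have cov: "is_fold_cover q G ?L ?H"
  proof (rule is_fold_cover_relation_cover[OF G])
    fix p p' c d
    assume "(p, p') \<in> parcs G" "M p p' c d"
    then show "M p' p d c"
      by (auto simp: M_def G_def cartesian_product_def complete_bipartite_graph_def split: sum.splits)
  next
    fix p p' c d e
    assume "(p, p') \<in> parcs G" "c < q" "d < q" "e < q" "M p p' c d" "M p p' c e"
    then show "d = e"
      by (cases "snd p"; cases "snd p'") (simp_all add: M_def, (metis mod_add_right_cancel_less)+)
  qed
  then have c: "is_cover G ?L ?H" by (simp add: is_fold_cover_def)
  have "cover_colorings G ?H = {}"
  proof (rule ccontr)
    assume "cover_colorings G ?H \<noteq> {}"
    then have "transversal_colorings G ?L ?H \<noteq> {}" using cover_colorings_empty_iff[OF G c] by simp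
    then have "{f \<in> pverts G \<rightarrow>\<^sub>E {..<q}. \<forall>(u, v)\<in>parcs G. \<not> M u v (f u) (f v)} \<noteq> {}"
      using transversal_colorings_relation_cover[OF G, of q M] unfolding bij_betw_def by blast
    then obtain F where F: "F \<in> pverts G \<rightarrow>\<^sub>E {..<q}" "\<And>u v. (u, v) \<in> parcs G \<Longrightarrow> \<not> M u v (F u) (F v)"
      by blast
    have Fq: "F (u, x) < q" if "u < n" "x \<in> {..<k} <+> {..<t}" for u x
      using PiE_mem[OF F(1), of "(u, x)"] that
      by (auto simp: G_def cartesian_product_def complete_bipartite_graph_def n_def)
    have proper: "\<forall>(u, v)\<in>parcs (cycle_graph n). F (u, x) \<noteq> F (v, x)" if "x \<in> {..<k} <+> {..<t}" for x
    proof clarify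
      fix u v assume "(u, v) \<in> parcs (cycle_graph n)" "F (u, x) = F (v, x)"
      moreover from this that have "((u, x), (v, x)) \<in> parcs G"
        by (simp add: G_def cartesian_product_def complete_bipartite_graph_def n_def)
      ultimately show False using F(2)[of "(u, x)" "(v, x)"] by (auto simp: M_def split: sum.splits)
    qed
    \<comment> \<open>\<open>s\<close> and \<open>r\<close> are the shifts and representatives of
      the k-side under \<open>F\<close>. The vertex \<open>j\<close> below was built for this
      \<open>r\<close> and a vector \<open>a\<close> suited to \<open>s\<close>.\<close>
    define s where "s = (\<lambda>i\<in>{..<k}. F (0, Inl i))"
    define r where "r = (\<lambda>i\<in>{..<k}. \<lambda>u\<in>{..<n}. (F (u, Inl i) + (q - F (0, Inl i))) mod q)"
    have s: "s \<in> {..<k} \<rightarrow>\<^sub>E {..<q}" using Fq by (auto simp: s_def n_def)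
    have r: "r \<in> R"
      unfolding R_def
    proof (rule PiE_I)
      fix i assume "i \<in> {..<k}"
      then have i: "Inl i \<in> {..<k} <+> {..<t}" by auto
      show "r i \<in> Reps"
        using normalized_coloring_in_cycle_colorings[of n "\<lambda>u. F (u, Inl i)" q, OF Fq[OF _ i] _ proper[OF i]]
          \<open>i \<in> {..<k}\<close> by (simp add: r_def Reps_def n_def)
    qed (simp add: r_def)
    obtain a where a: "a \<in> A" "inj_on (\<lambda>i. (s i + a i) mod q) {..<k}" using A(3)[OF s] by blast
    obtain j where j: "j < t" "h j = (r, a)" using h[of "(r, a)"] r a by auto
    then have \<rho>\<alpha>: "\<rho> j = r" "\<alpha> j = a" by (simp_all add: \<rho>_def \<alpha>_def)
    have jt: "Inr j \<in> {..<k} <+> {..<t}" using j by auto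
    \<comment> \<open>\<open>T\<close> is forbidden at every vertex of copy \<open>j\<close>;
      injectivity leaves exactly two of the \<open>k + 2\<close> colours.\<close>
    define T where "T = (\<lambda>i. (s i + a i) mod q) ` {..<k}"
    have "T \<subseteq> {..<q}" by (auto simp: T_def q_def)
    moreover have "card T = k" using card_image[OF a(2)] by (simp add: T_def)
    ultimately have card: "card ({..<q} - T) = 2"
      using finite_subset[of T "{..<q}"] by (simp add: card_Diff_subset q_def)
    have "F (u, Inr j) \<in> {..<q} - T" if u: "u < n" for u
    proof -
      have "F (u, Inr j) \<noteq> (s i + a i) mod q" if i: "i < k" for i
      proof
        assume eq: "F (u, Inr j) = (s i + a i) mod q"
        have si: "s i < q" using s i by auto
        \<comment> \<open>Modulo \<open>q\<close>, \<open>r i u\<close> is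
          \<open>F (u, Inl i) - s i\<close>, so \<open>s i\<close> cancels and the equation in
          \<open>M\<close> results.\<close>
        have "(F (u, Inr j) + r i u) mod q = ((s i + a i) + (F (u, Inl i) + (q - s i))) mod q"
          using i u by (simp add: eq r_def s_def mod_add_eq)
        also have "(s i + a i) + (F (u, Inl i) + (q - s i)) = (F (u, Inl i) + a i) + q"
          using si by simp
        finally have "M (u, Inl i) (u, Inr j) (F (u, Inl i)) (F (u, Inr j))"
          by (simp add: M_def \<rho>\<alpha>)
        moreover have "((u, Inl i), (u, Inr j)) \<in> parcs G"
          using i j u by (simp add: G_def cartesian_product_def complete_bipartite_graph_def n_def)
        ultimately show False using F(2) by blast
      qed
      then show ?thesis using Fq[OF u jt] by (auto simp: T_def)
    qed
    then show False
      using odd_cycle_not_2_colorable[of m "\<lambda>u. F (u, Inr j)", OF _ _ card] proper[OF jt]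
      by (simp add: n_def)
  qed
  then show ?thesis using cov unfolding q_def by blast
qed

section \<open>Upper bound by degeneracy\<close>

lemma card_cycle_neighbours_le: "card {v. (v, u) \<in> parcs (cycle_graph n)} \<le> 2"
proof -
  have "{v. (v, u) \<in> parcs (cycle_graph n)} \<subseteq> {Suc u mod n, if u = 0 then n - 1 else u - 1}"
    by (auto simp: cycle_graph_def mod_Suc split: if_splits)
  then have "card {v. (v, u) \<in> parcs (cycle_graph n)} \<le> card {Suc u mod n, if u = 0 then n - 1 else u - 1}"
    by (intro card_mono) auto
  also have "\<dots> \<le> 2" by (simp add: card_insert_if)
  finally show ?thesis .
qed

lemma cycle_bipartite_cover_colorable:
  assumes "n \<ge> 3" and "is_fold_cover (k + 3) (cycle_graph n \<box> complete_bipartite_graph k t) L H"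
  shows "cover_colorings (cycle_graph n \<box> complete_bipartite_graph k t) H \<noteq> {}"
proof (rule degenerate_imp_cover_colorable[OF _ assms(2)])
  let ?G = "cycle_graph n \<box> complete_bipartite_graph k t"
  show "pair_graph ?G"
    using assms(1)
    by (intro pair_graph_cartesian_product pair_graph_cycle_graph pair_graph_complete_bipartite_graph)
  fix W assume W: "W \<subseteq> pverts ?G" "W \<noteq> {}"
  define N where "N u = {v. (v, u) \<in> parcs (cycle_graph n)}" for u
  have N: "finite (N u)" "card (N u) \<le> 2" for u
    using card_cycle_neighbours_le[of u n]
    by (auto simp: N_def cycle_graph_def intro: finite_subset[of _ "{..<n}"])
  have N': "card ((\<lambda>v. (v, x)) ` N u) \<le> 2" for u and x :: "nat + nat"
    using card_image_le[OF N(1)[of u], of "\<lambda>v. (v, x)"] N(2)[of u] by linarith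
  show "\<exists>p\<in>W. card {p' \<in> W. (p', p) \<in> parcs ?G} < k + 3"
  proof (cases "\<exists>u j. (u, Inr j) \<in> W")
    case True
    then obtain u j where p: "(u, Inr j) \<in> W" by blast
    have "{p' \<in> W. (p', (u, Inr j)) \<in> parcs ?G} \<subseteq> (\<lambda>i. (u, Inl i)) ` {..<k} \<union> (\<lambda>v. (v, Inr j)) ` N u"
      by (auto simp: cartesian_product_def complete_bipartite_graph_def N_def)
    then have "card {p' \<in> W. (p', (u, Inr j)) \<in> parcs ?G}
        \<le> card ((\<lambda>i. (u, Inl i)) ` {..<k} \<union> (\<lambda>v. (v, Inr j)) ` N u)"
      using N(1) by (intro card_mono) auto
    also have "\<dots> \<le> card ((\<lambda>i. (u, Inl i :: nat + nat)) ` {..<k}) + card ((\<lambda>v. (v, Inr j :: nat + nat)) ` N u)"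
      by (rule card_Un_le)
    also have "\<dots> \<le> k + 2"
      using card_image_le[of "{..<k}" "\<lambda>i. (u, Inl i :: nat + nat)"] N'[of "Inr j" u] by simp
    finally show ?thesis using p by (intro bexI[of _ "(u, Inr j)"]) auto
  next
    case False
    then obtain u i where p: "(u, Inl i) \<in> W" using W(2) by (metis ex_in_conv old.sum.exhaust surj_pair)
    have "{p' \<in> W. (p', (u, Inl i)) \<in> parcs ?G} \<subseteq> (\<lambda>v. (v, Inl i)) ` N u"
      using False by (auto simp: cartesian_product_def complete_bipartite_graph_def N_def)
    then have "card {p' \<in> W. (p', (u, Inl i)) \<in> parcs ?G} \<le> card ((\<lambda>v. (v, Inl i :: nat + nat)) ` N u)"
      using N(1) by (intro card_mono) auto
    then have "card {p' \<in> W. (p', (u, Inl i)) \<in> parcs ?G} < k + 3" using N'[of "Inl i" u] by linarith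
    then show ?thesis using p by (intro bexI[of _ "(u, Inl i)"]) auto
  qed
qed

section \<open>Combining both bounds\<close>

theorem theorem7:
  fixes k m :: nat
  assumes "k \<ge> 1" and "m \<ge> 1"
  shows "of_int (dp_const k) * (real (dp_color_function (cycle_graph (2 * m + 1)) (k + 2)) / (real k + 2)) ^ k
       = of_int (dp_const k) * (((real k + 1) ^ (2 * m + 1) - (real k + 1)) / (real k + 2)) ^ k
    \<and> (\<forall>t :: nat.
       real t \<ge> of_int (dp_const k) * (real (dp_color_function (cycle_graph (2 * m + 1)) (k + 2)) / (real k + 2)) ^ k
       \<longrightarrow> dp_chromatic_number (cycle_graph (2 * m + 1) \<box> complete_bipartite_graph k t) = k + 3)"
proof -
  let ?C = "cycle_graph (2 * m + 1)"
  define Q where "Q = card {f \<in> cycle_colorings (2 * m + 1) (k + 2). f 0 = 0}"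
  have P: "int (dp_color_function ?C (k + 2)) = (int k + 1) ^ (2 * m + 1) - (int k + 1)"
    using dp_color_function_odd_cycle[OF assms(2), of "k + 2"] by (simp add: algebra_simps)
  then have "real_of_int (int (dp_color_function ?C (k + 2))) = real_of_int ((int k + 1) ^ (2 * m + 1) - (int k + 1))"
    by (simp only:)
  then have real_P: "real (dp_color_function ?C (k + 2)) = (real k + 1) ^ (2 * m + 1) - (real k + 1)"
    by (simp only: of_int_diff of_int_power of_int_add of_int_of_nat_eq of_int_1)
  \<comment> \<open>\<open>Q\<close> counts the colourings vanishing at \<open>0\<close>, so the
    quotient in the threshold for \<open>t\<close> is exactly the integer \<open>Q\<close>.\<close>
  have "int (k + 2) * int Q = int (dp_color_function ?C (k + 2))"
    unfolding P Q_def using card_cycle_colorings_at[of 0 "k + 2" m] by (simp add: algebra_simps)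
  then have "dp_color_function ?C (k + 2) = (k + 2) * Q"
    by (simp only: of_nat_eq_iff flip: of_nat_mult)
  then have Q: "real (dp_color_function ?C (k + 2)) / (real k + 2) = real Q"
    by (simp add: field_simps)
  have "dp_chromatic_number (?C \<box> complete_bipartite_graph k t) = k + 3"
    if t: "of_int (dp_const k) * (real (dp_color_function ?C (k + 2)) / (real k + 2)) ^ k \<le> real t" for t :: nat
    unfolding dp_chromatic_number_def
  proof (rule Least_equality)
    let ?G = "?C \<box> complete_bipartite_graph k t"
    show "\<forall>(L :: nat \<times> (nat + nat) \<Rightarrow> nat set) H. is_fold_cover (k + 3) ?G L H \<longrightarrow> cover_colorings ?G H \<noteq> {}"
      using assms(2) by (intro allI impI cycle_bipartite_cover_colorable) auto
    fix p
    assume p: "\<forall>(L :: nat \<times> (nat + nat) \<Rightarrow> nat set) H. is_fold_cover p ?G L H \<longrightarrow> cover_colorings ?G H \<noteq> {}"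
    \<comment> \<open>Otherwise the uncolourable \<open>(k + 2)\<close>-fold cover can be cut down
      to \<open>p\<close> vertices per part and relabelled by natural numbers, contradicting the
      choice of \<open>p\<close>.\<close>
    show "k + 3 \<le> p"
    proof (rule ccontr)
      assume "\<not> k + 3 \<le> p"
      then have le: "p \<le> k + 2" by simp
      have G: "pair_graph ?G"
        using assms(2)
        by (intro pair_graph_cartesian_product pair_graph_cycle_graph pair_graph_complete_bipartite_graph) simp
      obtain L :: "nat \<times> (nat + nat) \<Rightarrow> ((nat \<times> (nat + nat)) \<times> nat) set" and H
        where "is_fold_cover (k + 2) ?G L H" "cover_colorings ?G H = {}"
        using uncolorable_fold_cover_cycle_bipartite[OF assms, of t] t unfolding Q Q_def by blast
      from fold_cover_subfold_uncolorable[OF G this(1) le this(2)]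
      obtain L' :: "nat \<times> (nat + nat) \<Rightarrow> ((nat \<times> (nat + nat)) \<times> nat) set" and H'
        where L': "is_fold_cover p ?G L' H'" "cover_colorings ?G H' = {}" by blast
      from fold_cover_nat[OF G L'(1)]
      obtain L'' :: "nat \<times> (nat + nat) \<Rightarrow> nat set" and H'' \<phi>
        where L'': "is_fold_cover p ?G L'' H''"
          "bij_betw \<phi> (cover_colorings ?G H') (cover_colorings ?G H'')" by blast
      then have "cover_colorings ?G H'' = {}" using L'(2) by (simp add: bij_betw_def)
      then show False using p L''(1) by blast
    qed
  qed
  then show ?thesis by (simp only: real_P) simp
qed

end
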